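(* Using the pessimistic estimator $\mathrm{est}$ defined in the context, the deterministic rounding algorithm described in the context is a deterministic $(\alpha,\beta)$-approximation for the ANF problem with $\alpha=1-\frac1m$ and $\beta=\frac{3b\ln m}{\ln\ln m}$, where $b=1.85$, for $m\ge 9$, $m$ being the number of edges.
   Context: ANF (all-or-nothing multicommodity flow) problem: given a directed graph $G=(V,E)$, $m=|E|$, with capacities $c(e)>0$, and $k$ commodities $(s_i,t_i)$ with demands $d_i>0$ and weights $w_i>0$, $i\in[k]=\{1,\dots,k\}$, choose a set $K'\subseteq[k]$ and for each $i\in K'$ a (fractional, splittable) flow of $d_i$ units from $s_i$ to $t_i$ such that the load (total flow of all chosen commodities) of every edge $e$ is at most $c(e)$; maximize the throughput $\sum_{i\in K'}w_i$. A deterministic $(\alpha,\beta)$-approximation is a deterministic polynomial-time algorithm that outputs a solution whose throughput is at least $\alpha$ times the maximum throughput and whose load on every edge $e$ is at most $\beta\,c(e)$. Standing assumption: only commodities that can be satisfied by themselves in $G$ within the capacities are given as input (others are discarded). Compact edge-flow LP (variables $f_i$ and $f_{i,e}$, $i\in[k]$, $e\in E$): maximize $\sum_{i}w_if_i$ subject to $\sum_{(s_i,v)\in E}f_{i,(s_i,v)}=f_i$ for all $i$; $\sum_{(u,v)\in E}f_{i,(u,v)}=\sum_{(v,u)\in E}f_{i,(v,u)}$ for all $i$ and all $v\in V\setminus\{s_i,t_i\}$; $\sum_i f_{i,e}\,d_i\le c(e)$ for all $e$; $f_{i,e}\,d_i\le f_i\,c(e)$ for all $i,e$; $f_{i,e}\ge0$;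 $f_i\in[0,1]$. Let $(\tilde f_i,\tilde f_{i,e})$ be an optimal solution of this LP, $w_{LP}=\sum_iw_i\tilde f_i$, $w_{\max}=\max_iw_i$. Let $Z_1,\dots,Z_k$ be independent $\{0,1\}$-valued random variables with $\Pr[Z_i=1]=\tilde f_i$ and $\Pr[Z_i=0]=1-\tilde f_i$. Estimator: $\mathrm{est}(Z_1,\dots,Z_k)=\mathrm{est}_\alpha(Z_1,\dots,Z_k)+\sum_{e\in E}\mathrm{est}^e_\beta(Z_1,\dots,Z_k)$, where $\mathrm{est}_\alpha(Z_1,\dots,Z_k)=e^{-\theta_\alpha(1-\delta_\alpha)\tilde\mu}\prod_{i\in[k]}\mathrm{E}\big[e^{\theta_\alpha Z_iw_i/w_{\max}}\big]$ with $\delta_\alpha=\frac1m$, $\tilde\mu=\frac{w_{LP}}{w_{\max}}$, $\theta_\alpha=\ln(1-\delta_\alpha)$; and $\mathrm{est}^e_\beta(Z_1,\dots,Z_k)=e^{-\theta_\beta(1+\delta_\beta)\hat\mu}\prod_{i\in[k]}\mathrm{E}\big[e^{\theta_\beta Z_i\,d_i\tilde f_{i,e}/(\tilde f_i\,c(e))}\big]$ with $\delta_\beta=\frac{3b\ln m}{\ln\ln m}-1$, $b=1.85$, $\hat\mu=1$, $\theta_\beta=\ln(1+\delta_\beta)$. For fixed $z_1,\dots,z_i\in\{0,1\}$, the conditional expectation $\mathsf{Ex}(\mathrm{est}(z_1,\dots,z_i,Z_{i+1},\dots,Z_k))$ is the value of these expressions when $Z_1,\dots,Z_i$ are replaced by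 the constants $z_1,\dots,z_i$ and the expectations are taken over $Z_{i+1},\dots,Z_k$. Algorithm: compute the optimal LP solution; set $F\leftarrow\mathsf{Ex}(\mathrm{est}(Z_1,\dots,Z_k))$. For each $i=1,\dots,k$: if $\mathsf{Ex}(\mathrm{est}(z_1,\dots,z_{i-1},0,Z_{i+1},\dots,Z_k))<F$ set $z_i\leftarrow0$ (commodity $i$ is not routed), otherwise set $z_i\leftarrow1$ (commodity $i$ is routed); then update $F\leftarrow\mathsf{Ex}(\mathrm{est}(z_1,\dots,z_i,Z_{i+1},\dots,Z_k))$. Return the solution given by $z$: if $z_i=1$ then $f_i=1$ and $f_{i,e}=\tilde f_{i,e}/\tilde f_i$ for all $e$, else $f_i=f_{i,e}=0$; the flow of commodity $i$ on edge $e$ is $d_if_{i,e}$.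
   Formalization: The LP also requires zero flow of commodity i into s_i (else cycles through s_i count as flow); commodities with f̃_i=0 are never routed (else 0/0); time is unit-cost real arithmetic with exp and ln, given a polynomial-time exact LP solver. *)

theory Defs
  imports
    "HOL-Probability.Probability"
    "HOL-Computational_Algebra.Polynomial"
    "HOL-Library.Monad_Syntax"
    "Graph_Theory.Pair_Digraph"
begin

section \<open>The ANF problem\<close>

text \<open>
  Commodities are indexed by \<open>{1..ncom I}\<close>; the values of \<open>src\<close>, \<open>snk\<close>, \<open>dem\<close>, \<open>wt\<close> at other
  indices and of \<open>cap\<close> outside the edge set are irrelevant.
\<close>

record 'v anf_instance =
  net :: "'v pair_pre_digraph"
  cap :: "'v \<times> 'v \<Rightarrow> real"
  ncom :: nat
  src :: "nat \<Rightarrow> 'v"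
  snk :: "nat \<Rightarrow> 'v"
  dem :: "nat \<Rightarrow> real"
  wt :: "nat \<Rightarrow> real"

abbreviation edges :: "'v anf_instance \<Rightarrow> ('v \<times> 'v) set" where
  "edges I \<equiv> parcs (net I)"

abbreviation num_edges :: "'v anf_instance \<Rightarrow> nat" where
  "num_edges I \<equiv> card (edges I)"

text \<open>An \<open>s\<close>-\<open>t\<close> flow of value \<open>d\<close>: the value is the net outflow of the source.\<close>

definition st_flow :: "'v pair_pre_digraph \<Rightarrow> 'v \<Rightarrow> 'v \<Rightarrow> real \<Rightarrow> ('v \<times> 'v \<Rightarrow> real) \<Rightarrow> bool" where
  "st_flow G s t d g \<longleftrightarrow>
     (\<forall>e\<in>parcs G. 0 \<le> g e) \<and>
     (\<forall>v\<in>pverts G - {s, t}. (\<Sum>e\<in>out_arcs G v. g e) = (\<Sum>e\<in>in_arcs G v. g e)) \<and>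
     (\<Sum>e\<in>out_arcs G s. g e) - (\<Sum>e\<in>in_arcs G s. g e) = d"

text \<open>
  The last clause is the standing assumption that every commodity can be satisfied by itself.
  As demands are positive, it excludes \<open>src I i = snk I i\<close>.
\<close>

definition anf_instance :: "'v anf_instance \<Rightarrow> bool" where
  "anf_instance I \<longleftrightarrow>
     pair_fin_digraph (net I) \<and>
     (\<forall>e\<in>edges I. 0 < cap I e) \<and>
     (\<forall>i\<in>{1..ncom I}. src I i \<in> pverts (net I) \<and> snk I i \<in> pverts (net I) \<and>
        0 < dem I i \<and> 0 < wt I i) \<and>
     (\<forall>i\<in>{1..ncom I}. \<exists>g. st_flow (net I) (src I i) (snk I i) (dem I i) g \<and>
        (\<forall>e\<in>edges I. g e \<le> cap I e))"

text \<open>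
  A solution consists of a set \<open>K\<close> of chosen commodities and a flow \<open>g i\<close> for each \<open>i \<in> K\<close>.
  Capacities are not part of this notion; they bound the \<open>load\<close> separately.
\<close>

definition anf_solution :: "'v anf_instance \<Rightarrow> nat set \<Rightarrow> (nat \<Rightarrow> 'v \<times> 'v \<Rightarrow> real) \<Rightarrow> bool" where
  "anf_solution I K g \<longleftrightarrow>
     K \<subseteq> {1..ncom I} \<and> (\<forall>i\<in>K. st_flow (net I) (src I i) (snk I i) (dem I i) (g i))"

definition load :: "nat set \<Rightarrow> (nat \<Rightarrow> 'v \<times> 'v \<Rightarrow> real) \<Rightarrow> 'v \<times> 'v \<Rightarrow> real" where
  "load K g e = (\<Sum>i\<in>K. g i e)"

definition throughput :: "'v anf_instance \<Rightarrow> nat set \<Rightarrow> real" where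
  "throughput I K = (\<Sum>i\<in>K. wt I i)"

definition max_throughput :: "'v anf_instance \<Rightarrow> real" where
  "max_throughput I = Max {throughput I K | K g.
     anf_solution I K g \<and> (\<forall>e\<in>edges I. load K g e \<le> cap I e)}"


section \<open>The compact edge-flow LP\<close>

text \<open>The variables \<open>f\<^sub>i\<close> and \<open>f\<^sub>i\<^sub>,\<^sub>e\<close>; rounded solutions are represented in the same way.\<close>

record 'v frac_solution =
  amount :: "nat \<Rightarrow> real"
  eflow :: "nat \<Rightarrow> 'v \<times> 'v \<Rightarrow> real"

text \<open>
  The last clause makes explicit that a commodity sends no flow into its own source. Without it
  the first clause, which counts only the edges leaving the source, would also be satisfied by
  circulations through the source that never reach the sink.
\<close>

definition lp_feasible :: "'v anf_instance \<Rightarrow> 'v frac_solution \<Rightarrow> bool" where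
  "lp_feasible I x \<longleftrightarrow>
     (\<forall>i\<in>{1..ncom I}. (\<Sum>e\<in>out_arcs (net I) (src I i). eflow x i e) = amount x i) \<and>
     (\<forall>i\<in>{1..ncom I}. \<forall>v\<in>pverts (net I) - {src I i, snk I i}.
        (\<Sum>e\<in>in_arcs (net I) v. eflow x i e) = (\<Sum>e\<in>out_arcs (net I) v. eflow x i e)) \<and>
     (\<forall>e\<in>edges I. (\<Sum>i\<in>{1..ncom I}. eflow x i e * dem I i) \<le> cap I e) \<and>
     (\<forall>i\<in>{1..ncom I}. \<forall>e\<in>edges I. eflow x i e * dem I i \<le> amount x i * cap I e) \<and>
     (\<forall>i\<in>{1..ncom I}. \<forall>e\<in>edges I. 0 \<le> eflow x i e) \<and>
     (\<forall>i\<in>{1..ncom I}. 0 \<le> amount x i \<and> amount x i \<le> 1) \<and>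
     (\<forall>i\<in>{1..ncom I}. \<forall>e\<in>in_arcs (net I) (src I i). eflow x i e = 0)"

definition lp_value :: "'v anf_instance \<Rightarrow> 'v frac_solution \<Rightarrow> real" where
  "lp_value I x = (\<Sum>i\<in>{1..ncom I}. wt I i * amount x i)"

definition lp_optimal :: "'v anf_instance \<Rightarrow> 'v frac_solution \<Rightarrow> bool" where
  "lp_optimal I x \<longleftrightarrow>
     lp_feasible I x \<and> (\<forall>y. lp_feasible I y \<longrightarrow> lp_value I y \<le> lp_value I x)"


section \<open>The pessimistic estimator\<close>

definition w_max :: "'v anf_instance \<Rightarrow> real" where
  "w_max I = Max (wt I ` {1..ncom I})"

definition mu_tilde :: "'v anf_instance \<Rightarrow> 'v frac_solution \<Rightarrow> real" where
  "mu_tilde I x = lp_value I x / w_max I"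

definition mu_hat :: real where
  "mu_hat = 1"

definition b_const :: real where
  "b_const = 1.85"

definition delta_alpha :: "nat \<Rightarrow> real" where
  "delta_alpha m = 1 / real m"

definition theta_alpha :: "nat \<Rightarrow> real" where
  "theta_alpha m = ln (1 - delta_alpha m)"

definition delta_beta :: "nat \<Rightarrow> real" where
  "delta_beta m = 3 * b_const * ln (real m) / ln (ln (real m)) - 1"

definition theta_beta :: "nat \<Rightarrow> real" where
  "theta_beta m = ln (1 + delta_beta m)"

text \<open>
  The joint law of \<open>(Z\<^sub>1, \<dots>, Z\<^sub>k)\<close> in which \<open>Z\<^sub>1, \<dots>, Z\<^sub>i\<close> are the constants \<open>z 1, \<dots>, z i\<close> and the
  remaining \<open>Z\<^sub>j\<close> are independent with success probability \<open>amount x j\<close>.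
\<close>

definition Z_law ::
  "'v anf_instance \<Rightarrow> 'v frac_solution \<Rightarrow> (nat \<Rightarrow> bool) \<Rightarrow> nat \<Rightarrow> (nat \<Rightarrow> bool) pmf" where
  "Z_law I x z i = Pi_pmf {1..ncom I} False
     (\<lambda>j. if j \<le> i then return_pmf (z j) else bernoulli_pmf (amount x j))"

definition est_alpha ::
  "'v anf_instance \<Rightarrow> 'v frac_solution \<Rightarrow> (nat \<Rightarrow> bool) pmf \<Rightarrow> real" where
  "est_alpha I x Zs =
     exp (- theta_alpha (num_edges I) * (1 - delta_alpha (num_edges I)) * mu_tilde I x) *
     (\<Prod>i\<in>{1..ncom I}. measure_pmf.expectation Zs
        (\<lambda>Z. exp (theta_alpha (num_edges I) * of_bool (Z i) * wt I i / w_max I)))"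

text \<open>
  If \<open>amount x i = 0\<close> then \<open>Z i\<close> is almost surely \<open>False\<close>, so the exponent below is almost surely
  zero whatever value is given to the quotient.
\<close>

definition est_beta ::
  "'v anf_instance \<Rightarrow> 'v frac_solution \<Rightarrow> 'v \<times> 'v \<Rightarrow> (nat \<Rightarrow> bool) pmf \<Rightarrow> real" where
  "est_beta I x e Zs =
     exp (- theta_beta (num_edges I) * (1 + delta_beta (num_edges I)) * mu_hat) *
     (\<Prod>i\<in>{1..ncom I}. measure_pmf.expectation Zs
        (\<lambda>Z. exp (theta_beta (num_edges I) * of_bool (Z i) *
               (dem I i * eflow x i e / (amount x i * cap I e)))))"

definition est ::
  "'v anf_instance \<Rightarrow> 'v frac_solution \<Rightarrow> (nat \<Rightarrow> bool) pmf \<Rightarrow> real" where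
  "est I x Zs = est_alpha I x Zs + (\<Sum>e\<in>edges I. est_beta I x e Zs)"

definition Ex_est ::
  "'v anf_instance \<Rightarrow> 'v frac_solution \<Rightarrow> (nat \<Rightarrow> bool) \<Rightarrow> nat \<Rightarrow> real" where
  "Ex_est I x z i = est I x (Z_law I x z i)"


section \<open>The deterministic rounding algorithm\<close>

text \<open>
  \<open>derand I x i\<close> is the pair \<open>(z, F)\<close> after the first \<open>i\<close> rounds. A commodity with \<open>amount x i = 0\<close>
  has \<open>Z\<^sub>i = 0\<close> with probability one and is never routed, since \<open>eflow x i e / amount x i\<close> is
  meaningless for it.
\<close>

fun derand :: "'v anf_instance \<Rightarrow> 'v frac_solution \<Rightarrow> nat \<Rightarrow> (nat \<Rightarrow> bool) \<times> real" where
  "derand I x 0 = (\<lambda>_. False, Ex_est I x (\<lambda>_. False) 0)"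
| "derand I x (Suc i) =
     (let (z, F) = derand I x i;
          z' = z(Suc i := \<not> (amount x (Suc i) = 0 \<or> Ex_est I x (z(Suc i := False)) (Suc i) < F))
      in (z', Ex_est I x z' (Suc i)))"

definition rounded :: "'v anf_instance \<Rightarrow> 'v frac_solution \<Rightarrow> 'v frac_solution" where
  "rounded I x =
     (let z = fst (derand I x (ncom I))
      in \<lparr> amount = (\<lambda>i. if z i then 1 else 0),
           eflow = (\<lambda>i e. if z i \<and> e \<in> edges I then eflow x i e / amount x i else 0) \<rparr>)"


section \<open>Running time\<close>

text \<open>
  Computations on a unit-cost real RAM: a result together with the number of elementary steps
  (arithmetic operations, \<open>exp\<close>, \<open>ln\<close>, comparisons, assignments, loop iterations) that were
  performed. Every argument of \<open>tick\<close> is a single elementary operation; reading inputs and array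
  entries is free.
\<close>

datatype 'a timed = Timed (result: 'a) (steps: nat)

definition bind_timed :: "'a timed \<Rightarrow> ('a \<Rightarrow> 'b timed) \<Rightarrow> 'b timed" where
  "bind_timed p q = Timed (result (q (result p))) (steps p + steps (q (result p)))"

adhoc_overloading Monad_Syntax.bind \<rightleftharpoons> bind_timed

definition tick :: "'a \<Rightarrow> 'a timed" where
  "tick a = Timed a 1"

fun for_each :: "'a list \<Rightarrow> 's \<Rightarrow> ('a \<Rightarrow> 's \<Rightarrow> 's timed) \<Rightarrow> 's timed" where
  "for_each [] s body = tick s"
| "for_each (a # as) s body = do { s \<leftarrow> body a s; _ \<leftarrow> tick (); for_each as s body }"

definition polytime :: "('i \<Rightarrow> nat) \<Rightarrow> 'i set \<Rightarrow> ('i \<Rightarrow> 'o timed) \<Rightarrow> bool" where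
  "polytime isize D A \<longleftrightarrow> (\<exists>p :: nat poly. \<forall>I\<in>D. steps (A I) \<le> poly p (isize I))"

text \<open>The order in which the input lists the edges.\<close>

definition edge_list :: "'v anf_instance \<Rightarrow> ('v \<times> 'v) list" where
  "edge_list I = (SOME es. distinct es \<and> set es = edges I)"

text \<open>
  \<open>factor_prog\<close> evaluates the expectation of \<open>exp (\<theta> * Z\<^sub>j * a)\<close> when \<open>Z\<^sub>1, \<dots>, Z\<^sub>i\<close> are fixed.
\<close>

definition factor_prog ::
  "'v frac_solution \<Rightarrow> (nat \<Rightarrow> bool) \<Rightarrow> nat \<Rightarrow> real \<Rightarrow> nat \<Rightarrow> real \<Rightarrow> real timed" where
  "factor_prog x z i \<theta> j a = do {
     fixed \<leftarrow> tick (j \<le> i);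
     y \<leftarrow> tick (\<theta> * a);
     y \<leftarrow> tick (exp y);
     if fixed then (if z j then tick y else tick 1)
     else do {
       y \<leftarrow> tick (amount x j * y);
       q \<leftarrow> tick (1 - amount x j);
       tick (q + y)
     }
   }"

definition est_alpha_prog ::
  "'v anf_instance \<Rightarrow> 'v frac_solution \<Rightarrow> (nat \<Rightarrow> bool) \<Rightarrow> nat \<Rightarrow> real timed" where
  "est_alpha_prog I x z i = do {
     wm \<leftarrow> for_each [1..<Suc (ncom I)] 0 (\<lambda>j s. tick (max s (wt I j)));
     wl \<leftarrow> for_each [1..<Suc (ncom I)] 0 (\<lambda>j s. do { y \<leftarrow> tick (wt I j * amount x j); tick (s + y) });
     mu \<leftarrow> tick (wl / wm);
     m \<leftarrow> for_each (edge_list I) 0 (\<lambda>_ s. tick (s + 1));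
     d \<leftarrow> tick (1 / m);
     d \<leftarrow> tick (1 - d);
     \<theta> \<leftarrow> tick (ln d);
     p \<leftarrow> for_each [1..<Suc (ncom I)] 1 (\<lambda>j p. do {
       a \<leftarrow> tick (wt I j / wm);
       y \<leftarrow> factor_prog x z i \<theta> j a;
       tick (p * y)
     });
     c \<leftarrow> tick (- \<theta>);
     c \<leftarrow> tick (c * d);
     c \<leftarrow> tick (c * mu);
     c \<leftarrow> tick (exp c);
     tick (c * p)
   }"

definition est_beta_prog ::
  "'v anf_instance \<Rightarrow> 'v frac_solution \<Rightarrow> 'v \<times> 'v \<Rightarrow> (nat \<Rightarrow> bool) \<Rightarrow> nat \<Rightarrow> real timed" where
  "est_beta_prog I x e z i = do {
     m \<leftarrow> for_each (edge_list I) 0 (\<lambda>_ s. tick (s + 1));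
     l \<leftarrow> tick (ln m);
     ll \<leftarrow> tick (ln l);
     d \<leftarrow> tick (3 * b_const);
     d \<leftarrow> tick (d * l);
     d \<leftarrow> tick (d / ll);
     \<theta> \<leftarrow> tick (ln d);
     p \<leftarrow> for_each [1..<Suc (ncom I)] 1 (\<lambda>j p. do {
       routable \<leftarrow> tick (amount x j \<noteq> 0);
       a \<leftarrow> (if routable then do {
               n \<leftarrow> tick (dem I j * eflow x j e);
               c \<leftarrow> tick (amount x j * cap I e);
               tick (n / c)
             } else tick 0);
       y \<leftarrow> factor_prog x z i \<theta> j a;
       tick (p * y)
     });
     c \<leftarrow> tick (- \<theta>);
     c \<leftarrow> tick (c * d);
     c \<leftarrow> tick (c * mu_hat);
     c \<leftarrow> tick (exp c);
     tick (c * p)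
   }"

definition Ex_est_prog ::
  "'v anf_instance \<Rightarrow> 'v frac_solution \<Rightarrow> (nat \<Rightarrow> bool) \<Rightarrow> nat \<Rightarrow> real timed" where
  "Ex_est_prog I x z i = do {
     a \<leftarrow> est_alpha_prog I x z i;
     for_each (edge_list I) a (\<lambda>e s. do { y \<leftarrow> est_beta_prog I x e z i; tick (s + y) })
   }"

definition rounding_prog ::
  "('v anf_instance \<Rightarrow> 'v frac_solution timed) \<Rightarrow> 'v anf_instance \<Rightarrow> 'v frac_solution timed" where
  "rounding_prog lp_solver I = do {
     x \<leftarrow> lp_solver I;
     F \<leftarrow> Ex_est_prog I x (\<lambda>_. False) 0;
     (z, F) \<leftarrow> for_each [1..<Suc (ncom I)] (\<lambda>_. False, F) (\<lambda>i (z, F). do {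
       zero \<leftarrow> tick (amount x i = 0);
       z0 \<leftarrow> tick (z(i := False));
       F0 \<leftarrow> Ex_est_prog I x z0 i;
       less \<leftarrow> tick (F0 < F);
       z \<leftarrow> tick (z(i := \<not> (zero \<or> less)));
       F \<leftarrow> Ex_est_prog I x z i;
       tick (z, F)
     });
     f \<leftarrow> for_each [1..<Suc (ncom I)] (\<lambda>_. 0) (\<lambda>i f.
       if z i then tick (f(i := 1)) else tick (f(i := 0)));
     g \<leftarrow> for_each [1..<Suc (ncom I)] (\<lambda>_ _. 0) (\<lambda>i g.
       for_each (edge_list I) g (\<lambda>e g. do {
         y \<leftarrow> (if z i then tick (eflow x i e / amount x i) else tick 0);
         tick (g(i := (g i)(e := y)))
       }));
     tick \<lparr> amount = f, eflow = g \<rparr>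
   }"


section \<open>Approximation algorithms\<close>

text \<open>
  The output \<open>x\<close> of an algorithm stands for the solution that routes the commodities with
  \<open>amount x i = 1\<close> and sends \<open>dem I i * eflow x i e\<close> units of commodity \<open>i\<close> along \<open>e\<close>. The ratios
  may depend on the instance.
\<close>

definition routed :: "'v anf_instance \<Rightarrow> 'v frac_solution \<Rightarrow> nat set" where
  "routed I x = {i\<in>{1..ncom I}. amount x i = 1}"

definition flow_of :: "'v anf_instance \<Rightarrow> 'v frac_solution \<Rightarrow> nat \<Rightarrow> 'v \<times> 'v \<Rightarrow> real" where
  "flow_of I x i e = dem I i * eflow x i e"

definition det_approximation ::
  "('v anf_instance \<Rightarrow> nat) \<Rightarrow> 'v anf_instance set \<Rightarrow>
   ('v anf_instance \<Rightarrow> real) \<Rightarrow> ('v anf_instance \<Rightarrow> real) \<Rightarrow>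
   ('v anf_instance \<Rightarrow> 'v frac_solution timed) \<Rightarrow> bool" where
  "det_approximation isize D \<alpha> \<beta> A \<longleftrightarrow>
     polytime isize D A \<and>
     (\<forall>I\<in>D. let x = result (A I); K = routed I x; g = flow_of I x in
        (\<forall>i\<in>{1..ncom I}. amount x i \<in> {0, 1}) \<and>
        (\<forall>i\<in>{1..ncom I} - K. \<forall>e\<in>edges I. eflow x i e = 0) \<and>
        anf_solution I K g \<and>
        throughput I K \<ge> \<alpha> I * max_throughput I \<and>
        (\<forall>e\<in>edges I. load K g e \<le> \<beta> I * cap I e))"

end

theory Submission
  imports Defs
begin

text \<open>
  The optimal LP value bounds the maximum throughput, and by the standing assumption it is at least
  \<open>w_max\<close>, so \<open>mu_tilde \<ge> 1\<close>. To turn an integral solution into an LP solution one has to remove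
  the flow entering the sources, which is done by cancelling circulations through them.

  The estimator is affine in each \<open>Z\<^sub>i\<close>, hence its value before round \<open>i\<close> is a convex
  combination of the values for the two possible choices, and the algorithm never increases it.
  By Chernoff-type estimates the initial value is at most \<open>exp (- 1 / (2 * m\<^sup>2)) + m * m powr (- 4)\<close>,
  which is below \<open>1\<close>. At the end each of the nonnegative summands is therefore below \<open>1\<close>, and such a
  summand is the exponential of a multiple of the deviation from the throughput or load bound.
\<close>

section \<open>Flows without inflow into the source\<close>

lemma out_arcs_pair: "out_arcs (with_proj G) v = {e \<in> parcs G. fst e = v}"
  and in_arcs_pair: "in_arcs (with_proj G) v = {e \<in> parcs G. snd e = v}"
  by (auto simp: out_arcs_def in_arcs_def)

text \<open>Net outflow is linear in \<open>g\<close>, so adding a walk or subtracting a circulation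
  only requires adding or subtracting values of \<open>netout\<close>.\<close>

definition netout :: "('v \<times> 'v) set \<Rightarrow> ('v \<times> 'v \<Rightarrow> real) \<Rightarrow> 'v \<Rightarrow> real" where
  "netout E g v = (\<Sum>e | e \<in> E \<and> fst e = v. g e) - (\<Sum>e | e \<in> E \<and> snd e = v. g e)"

lemma st_flow_netout:
  "st_flow G s t d g \<longleftrightarrow>
     (\<forall>e\<in>parcs G. 0 \<le> g e) \<and> (\<forall>v\<in>pverts G - {s, t}. netout (parcs G) g v = 0) \<and>
     netout (parcs G) g s = d"
  by (simp add: st_flow_def netout_def out_arcs_pair in_arcs_pair)

lemma netout_sub_mult:
  "netout E (\<lambda>e. g e - c * h e) v = netout E g v - c * netout E h v"
  by (simp add: netout_def sum_subtractf sum_distrib_left[symmetric] algebra_simps)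

lemma netout_add:
  "netout E (\<lambda>e. g e + h e) v = netout E g v + netout E h v"
  by (simp add: netout_def sum.distrib algebra_simps)

lemma netout_single:
  assumes "finite E" "(a, b) \<in> E"
  shows "netout E (\<lambda>e. of_bool (e = (a, b))) v = of_bool (v = a) - of_bool (v = b)"
proof -
  have "(\<Sum>e | e \<in> E \<and> P e. of_bool (e = (a, b)) :: real) = of_bool (P (a, b))" for P
  proof (cases "P (a, b)")
    case True
    then have "{e \<in> E. P e} \<inter> {e. e = (a, b)} = {(a, b)}"
      using assms by auto
    then show ?thesis
      using assms True by simp
  next
    case False
    then show ?thesis
      using assms by (auto intro: sum.neutral)
  qed
  from this[of "\<lambda>e. fst e = v"] this[of "\<lambda>e. snd e = v"] show ?thesis
    by (auto simp: netout_def)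
qed

text \<open>Each arc is counted once at its tail and once at its head, so arcs inside
  \<open>S\<close> contribute to both sums and only the boundary of \<open>S\<close>
  matters.\<close>

lemma sum_netout:
  assumes "finite E" "finite S"
  shows "(\<Sum>v\<in>S. netout E g v) =
    (\<Sum>e | e \<in> E \<and> fst e \<in> S. g e) - (\<Sum>e | e \<in> E \<and> snd e \<in> S. g e)"
proof -
  have *: "(\<Sum>v\<in>S. \<Sum>e | e \<in> E \<and> h e = v. g e) = (\<Sum>e | e \<in> E \<and> h e \<in> S. g e)"
    for h :: "'a \<times> 'a \<Rightarrow> 'a"
  proof -
    have "(\<Sum>v\<in>S. \<Sum>e | e \<in> E \<and> h e = v. g e) =
        (\<Sum>v\<in>S. \<Sum>e | e \<in> {e \<in> E. h e \<in> S} \<and> h e = v. g e)"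
      by (intro sum.cong) auto
    also have "\<dots> = (\<Sum>e | e \<in> E \<and> h e \<in> S. g e)"
      by (rule sum.group) (use assms in auto)
    finally show ?thesis .
  qed
  show ?thesis
    by (simp add: netout_def sum_subtractf *)
qed

text \<open>Every arc of the walk carries one unit per traversal, and the contributions at inner
  vertices cancel. The walk need not be simple: \<phi> counts multiplicities.\<close>

lemma netout_walk:
  assumes "finite E" "r \<subseteq> E" "(a, b) \<in> r\<^sup>*"
  shows "\<exists>\<phi>. (\<forall>e. 0 \<le> \<phi> e) \<and> (\<forall>e. e \<notin> r \<longrightarrow> \<phi> e = 0) \<and>
    (\<forall>v. netout E \<phi> v = of_bool (v = a) - of_bool (v = b))"
  using assms(3)
proof (induction rule: rtrancl_induct)
  case base
  show ?case
    by (rule exI[of _ "\<lambda>_. 0"]) (simp add: netout_def)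
next
  case (step b c)
  then obtain \<phi> where \<phi>: "\<forall>e. 0 \<le> \<phi> e" "\<forall>e. e \<notin> r \<longrightarrow> \<phi> e = 0"
    "\<forall>v. netout E \<phi> v = of_bool (v = a) - of_bool (v = b)"
    by blast
  have "(b, c) \<in> E"
    using step assms by blast
  with \<phi> step show ?case
    by (intro exI[of _ "\<lambda>e. \<phi> e + of_bool (e = (b, c))"])
      (auto simp: netout_add netout_single[OF assms(1)])
qed

text \<open>Otherwise the vertices reachable from \<open>s\<close> through flow-carrying arcs would have a negative
  net outflow in total.\<close>

lemma flow_returns_to_source:
  assumes G: "pair_fin_digraph G" and g: "st_flow G s t d g" and d: "0 \<le> d"
    and us: "(u, s) \<in> parcs G" "0 < g (u, s)"
  shows "(s, u) \<in> {e \<in> parcs G. 0 < g e}\<^sup>*"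
proof (rule ccontr)
  interpret pair_fin_digraph G by fact
  let ?r = "{e \<in> parcs G. 0 < g e}"
  define S where "S = {v \<in> pverts G. (s, v) \<in> ?r\<^sup>*}"
  assume "(s, u) \<notin> ?r\<^sup>*"
  then have u: "u \<notin> S"
    by (simp add: S_def)
  have nonneg: "\<forall>e\<in>parcs G. 0 \<le> g e" and net: "\<And>v. v \<in> pverts G - {s, t} \<Longrightarrow> netout (parcs G) g v = 0"
    and net_s: "netout (parcs G) g s = d"
    using g by (auto simp: st_flow_netout)
  have V: "fst e \<in> pverts G" "snd e \<in> pverts G" if "e \<in> parcs G" for e
    using arc_fst_in_verts[OF that] arc_snd_in_verts[OF that] by simp_all
  have s: "s \<in> S" "s \<in> pverts G"
    using V(2)[OF us(1)] by (auto simp: S_def)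
  have fin: "finite S" "finite (pverts G)" "finite (parcs G)"
    by (auto simp: S_def)
  have "(\<Sum>v\<in>pverts G. netout (parcs G) g v) = 0"
  proof -
    have "{e \<in> parcs G. fst e \<in> pverts G} = {e \<in> parcs G. snd e \<in> pverts G}"
      using V by blast
    then show ?thesis
      by (simp add: sum_netout fin)
  qed
  moreover have "(\<Sum>v\<in>pverts G. netout (parcs G) g v) = (\<Sum>v\<in>pverts G \<inter> {s, t}. netout (parcs G) g v)"
    by (rule sum.mono_neutral_right) (use net fin in auto)
  ultimately have st: "(\<Sum>v\<in>pverts G \<inter> {s, t}. netout (parcs G) g v) = 0"
    by simp
  have "(\<Sum>v\<in>S. netout (parcs G) g v) = (\<Sum>v\<in>S \<inter> {s, t}. netout (parcs G) g v)"
    by (rule sum.mono_neutral_right) (use net fin in \<open>auto simp: S_def\<close>)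
  \<comment> \<open>Either \<open>S\<close> contains both terminals that are vertices, whose total
    vanishes by the sum over all vertices, or only \<open>s\<close> counts, with value
    \<open>d\<close>.\<close>
  also have "\<dots> \<ge> 0"
  proof (cases "t \<in> S")
    case True
    then have "S \<inter> {s, t} = pverts G \<inter> {s, t}"
      using s by (auto simp: S_def)
    then show ?thesis
      using st by simp
  next
    case False
    then have "S \<inter> {s, t} = {s}"
      using s by auto
    then show ?thesis
      using net_s d by simp
  qed
  finally have "0 \<le> (\<Sum>v\<in>S. netout (parcs G) g v)" .
  \<comment> \<open>A flow-carrying arc with tail in \<open>S\<close> also has its head in
    \<open>S\<close>, while \<open>(u, s)\<close> enters \<open>S\<close> from outside.\<close>
  moreover have "(\<Sum>e | e \<in> parcs G \<and> fst e \<in> S. g e) + g (u, s) \<le> (\<Sum>e | e \<in> parcs G \<and> snd e \<in> S. g e)"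
  proof -
    have "(\<Sum>e | e \<in> parcs G \<and> fst e \<in> S. g e) = (\<Sum>e | e \<in> parcs G \<and> fst e \<in> S \<and> snd e \<in> S. g e)"
    proof (rule sum.mono_neutral_right)
      have "snd e \<in> S" if "e \<in> parcs G" "fst e \<in> S" "g e \<noteq> 0" for e
      proof -
        have "e \<in> ?r"
          using that nonneg by (auto simp: order_less_le)
        then have "(fst e, snd e) \<in> ?r"
          by simp
        then have "(s, snd e) \<in> ?r\<^sup>*"
          using that(2) unfolding S_def by (auto intro: rtrancl.rtrancl_into_rtrancl)
        then show ?thesis
          using V(2)[OF that(1)] by (simp add: S_def)
      qed
      then show "\<forall>e\<in>{e \<in> parcs G. fst e \<in> S} - {e \<in> parcs G. fst e \<in> S \<and> snd e \<in> S}. g e = 0"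
        by blast
    qed (use fin in auto)
    moreover have "(\<Sum>e\<in>insert (u, s) {e \<in> parcs G. fst e \<in> S \<and> snd e \<in> S}. g e) \<le>
        (\<Sum>e | e \<in> parcs G \<and> snd e \<in> S. g e)"
      by (rule sum_mono2) (use fin us s nonneg in auto)
    ultimately show ?thesis
      using u fin by simp
  qed
  ultimately show False
    using us(2) by (simp add: sum_netout fin)
qed

text \<open>Induction on the number of flow-carrying arcs. An arc bringing flow into
  \<open>s\<close> closes to a circulation on such arcs; subtracting as much of it as nonnegativity
  permits empties an arc and leaves every net outflow unchanged.\<close>

lemma st_flow_without_source_inflow:
  assumes G: "pair_fin_digraph G" and g: "st_flow G s t d g" and d: "0 \<le> d"
  obtains h where "st_flow G s t d h" "\<forall>e\<in>parcs G. h e \<le> g e"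
    "\<forall>e\<in>in_arcs (with_proj G) s. h e = 0"
proof -
  interpret pair_fin_digraph G by fact
  have "\<exists>h. st_flow G s t d h \<and> (\<forall>e\<in>parcs G. h e \<le> g e) \<and> (\<forall>e\<in>in_arcs (with_proj G) s. h e = 0)"
    using g
  proof (induction "card {e \<in> parcs G. 0 < g e}" arbitrary: g rule: less_induct)
    case less
    let ?E = "parcs G" and ?r = "{e \<in> parcs G. 0 < g e}"
    have nonneg: "0 \<le> g e" if "e \<in> ?E" for e
      using less.prems that by (simp add: st_flow_def)
    show ?case
    proof (cases "\<forall>e\<in>in_arcs (with_proj G) s. g e = 0")
      case True
      then show ?thesis
        using less.prems by blast
    next
      case False
      then obtain u where u: "(u, s) \<in> ?E" "0 < g (u, s)"
        using nonneg by (force simp: in_arcs_pair order_less_le)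
      from flow_returns_to_source[OF G less.prems d this]
      obtain \<phi>' where \<phi>': "\<forall>e. 0 \<le> \<phi>' e" "\<forall>e. e \<notin> ?r \<longrightarrow> \<phi>' e = 0"
        "\<forall>v. netout ?E \<phi>' v = of_bool (v = s) - of_bool (v = u)"
        using netout_walk[of ?E ?r s u] by auto
      \<comment> \<open>The arc \<open>(u, s)\<close> closes the walk from \<open>s\<close> to
        \<open>u\<close> to a circulation.\<close>
      define \<phi> where "\<phi> = (\<lambda>e. \<phi>' e + of_bool (e = (u, s)))"
      have circ: "netout ?E \<phi> v = 0" for v
        using \<phi>'(3) u by (simp add: \<phi>_def netout_add netout_single)
      have \<phi>: "0 \<le> \<phi> e" "e \<notin> ?r \<Longrightarrow> \<phi> e = 0" "0 < \<phi> (u, s)" for e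
        using \<phi>'(1)[rule_format, of e] \<phi>'(1)[rule_format, of "(u, s)"] \<phi>'(2)[rule_format, of e] u
        by (auto simp: \<phi>_def)
      define C where "C = {e \<in> ?E. 0 < \<phi> e}"
      have "(u, s) \<in> C"
        using \<phi>(3) u by (simp add: C_def)
      moreover have "C \<subseteq> ?r"
        unfolding C_def using \<phi>(2) by fastforce
      ultimately have C: "finite C" "C \<noteq> {}" "C \<subseteq> ?r"
        by (auto simp: C_def)
      obtain e0 where e0: "e0 \<in> C" "\<And>e. e \<in> C \<Longrightarrow> g e0 / \<phi> e0 \<le> g e / \<phi> e"
        using ex_is_arg_min_if_finite[OF C(1,2), of "\<lambda>e. g e / \<phi> e"]
        by (auto simp: is_arg_min_linorder)
      \<comment> \<open>The minimal ratio over the support of \<phi> is the largest multiple that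
        keeps the flow nonnegative; the flow on \<open>e0\<close> becomes zero.\<close>
      define c where "c = g e0 / \<phi> e0"
      define g' where "g' = (\<lambda>e. g e - c * \<phi> e)"
      have "0 < g e0" "0 < \<phi> e0"
        using e0(1) C(3) by (auto simp: C_def)
      then have c: "0 < c"
        by (simp add: c_def)
      have g'_le: "g' e \<le> g e" for e
        using c \<phi>(1) by (simp add: g'_def)
      have g'_nonneg: "0 \<le> g' e" if "e \<in> ?E" for e
      proof (cases "e \<in> C")
        case True
        with e0(2)[OF True] show ?thesis
          by (simp add: g'_def c_def C_def field_simps)
      next
        case False
        then have "\<phi> e = 0"
          using that \<phi>(1)[of e] by (auto simp: C_def)
        then show ?thesis
          using nonneg[OF that] by (simp add: g'_def)
      qed
      have "st_flow G s t d g'"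
        using less.prems g'_nonneg
        by (simp add: st_flow_netout g'_def netout_sub_mult circ)
      moreover have "card {e \<in> ?E. 0 < g' e} < card ?r"
      proof (rule psubset_card_mono)
        have "g' e0 = 0"
          using e0(1) by (simp add: g'_def c_def C_def)
        then have "e0 \<in> ?r - {e \<in> ?E. 0 < g' e}"
          using e0(1) C by auto
        then show "{e \<in> ?E. 0 < g' e} \<subset> ?r"
          using g'_le by (auto intro: less_le_trans)
      qed auto
      ultimately obtain h where "st_flow G s t d h" "\<forall>e\<in>?E. h e \<le> g' e"
        "\<forall>e\<in>in_arcs (with_proj G) s. h e = 0"
        using less.hyps by blast
      then show ?thesis
        by (intro exI[of _ h]) (auto intro: order_trans[OF _ g'_le])
    qed
  qed
  then show thesis
    using that by blast
qed

section \<open>The LP optimum against integral solutions\<close>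

text \<open>An integral solution, freed of inflow into the sources and scaled by the demands, is
  feasible for the LP with the throughput as its value.\<close>

lemma throughput_le_lp_value:
  assumes I: "anf_instance I" and x: "lp_optimal I x"
    and K: "anf_solution I K g" and cap: "\<forall>e\<in>edges I. load K g e \<le> cap I e"
  shows "throughput I K \<le> lp_value I x"
proof -
  have G: "pair_fin_digraph (net I)"
    and dem: "\<And>i. i \<in> {1..ncom I} \<Longrightarrow> 0 < dem I i"
    using I by (auto simp: anf_instance_def)
  have sub: "K \<subseteq> {1..ncom I}" and flow: "\<And>i. i \<in> K \<Longrightarrow> st_flow (net I) (src I i) (snk I i) (dem I i) (g i)"
    using K by (auto simp: anf_solution_def)
  have "\<forall>i\<in>K. \<exists>h. st_flow (net I) (src I i) (snk I i) (dem I i) h \<and> (\<forall>e\<in>edges I. h e \<le> g i e) \<and>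
      (\<forall>e\<in>in_arcs (with_proj (net I)) (src I i). h e = 0)"
  proof
    fix i assume i: "i \<in> K"
    have "0 \<le> dem I i"
      using dem[of i] sub i by auto
    from st_flow_without_source_inflow[OF G flow[OF i] this] obtain h where
      "st_flow (net I) (src I i) (snk I i) (dem I i) h" "\<forall>e\<in>edges I. h e \<le> g i e"
      "\<forall>e\<in>in_arcs (with_proj (net I)) (src I i). h e = 0" .
    then show "\<exists>h. st_flow (net I) (src I i) (snk I i) (dem I i) h \<and> (\<forall>e\<in>edges I. h e \<le> g i e) \<and>
        (\<forall>e\<in>in_arcs (with_proj (net I)) (src I i). h e = 0)"
      by (intro exI conjI)
  qed
  from bchoice[OF this] obtain h where
    hK: "\<forall>i\<in>K. st_flow (net I) (src I i) (snk I i) (dem I i) (h i) \<and> (\<forall>e\<in>edges I. h i e \<le> g i e) \<and>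
      (\<forall>e\<in>in_arcs (with_proj (net I)) (src I i). h i e = 0)" ..
  have h: "\<And>i. i \<in> K \<Longrightarrow> st_flow (net I) (src I i) (snk I i) (dem I i) (h i)"
    "\<And>i e. i \<in> K \<Longrightarrow> e \<in> edges I \<Longrightarrow> h i e \<le> g i e"
    "\<And>i e. i \<in> K \<Longrightarrow> e \<in> in_arcs (with_proj (net I)) (src I i) \<Longrightarrow> h i e = 0"
    using hK by simp_all
  have h_nonneg: "0 \<le> h i e" if "i \<in> K" "e \<in> edges I" for i e
    using h(1)[OF that(1)] that by (auto simp: st_flow_def)
  have finK: "finite K"
    using sub finite_subset by blast
  \<comment> \<open>On \<open>K\<close> this gives \<open>eflow y i e * dem I i = h i e\<close>, so
    the capacity constraints of the LP become bounds on \<open>h\<close>.\<close>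
  define y where "y = \<lparr> amount = (\<lambda>i. of_bool (i \<in> K)),
    eflow = (\<lambda>i e. if i \<in> K then h i e / dem I i else 0) \<rparr>"
  have load_h: "(\<Sum>i\<in>K. h i e) \<le> cap I e" if "e \<in> edges I" for e
  proof -
    have "(\<Sum>i\<in>K. h i e) \<le> load K g e"
      unfolding load_def using h(2) that by (intro sum_mono) auto
    then show ?thesis
      using cap that by force
  qed
  \<comment> \<open>Needed for the LP constraint on single commodities, where
    \<open>amount y i = 1\<close>.\<close>
  have h_cap: "h i e \<le> cap I e" if "i \<in> K" "e \<in> edges I" for i e
  proof -
    have "h i e \<le> (\<Sum>i\<in>K. h i e)"
      using h_nonneg that finK by (intro member_le_sum) auto
    then show ?thesis
      using load_h[OF that(2)] by simp
  qed
  have "lp_feasible I y"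
    unfolding lp_feasible_def
  proof (intro conjI ballI)
    fix i assume i: "i \<in> {1..ncom I}"
    show "(\<Sum>e\<in>out_arcs (net I) (src I i). eflow y i e) = amount y i"
    proof (cases "i \<in> K")
      case True
      then have "(\<Sum>e\<in>out_arcs (with_proj (net I)) (src I i). h i e) = dem I i"
        using h(1)[OF True] h(3)[OF True] by (simp add: st_flow_def)
      then show ?thesis
        using True dem[OF i] by (simp add: y_def sum_divide_distrib[symmetric])
    qed (simp add: y_def)
  next
    fix i v assume "i \<in> {1..ncom I}" "v \<in> pverts (net I) - {src I i, snk I i}"
    then show "(\<Sum>e\<in>in_arcs (net I) v. eflow y i e) = (\<Sum>e\<in>out_arcs (net I) v. eflow y i e)"
      using h(1)[of i] by (cases "i \<in> K") (simp_all add: y_def st_flow_def sum_divide_distrib[symmetric])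
  next
    fix e assume e: "e \<in> edges I"
    have "(\<Sum>i\<in>{1..ncom I}. eflow y i e * dem I i) = (\<Sum>i\<in>K. h i e)"
      using sub dem by (intro sum.mono_neutral_cong_right) (force simp: y_def)+
    then show "(\<Sum>i\<in>{1..ncom I}. eflow y i e * dem I i) \<le> cap I e"
      using load_h[OF e] by simp
  next
    fix i e assume "i \<in> {1..ncom I}" "e \<in> edges I"
    then show "eflow y i e * dem I i \<le> amount y i * cap I e" "0 \<le> eflow y i e"
      using h_cap[of i e] h_nonneg[of i e] dem[of i] by (auto simp: y_def)
  next
    fix i e assume "i \<in> {1..ncom I}" "e \<in> in_arcs (net I) (src I i)"
    then show "eflow y i e = 0"
      using h(3)[of i e] by (auto simp: y_def)
  qed (auto simp: y_def)
  then have "lp_value I y \<le> lp_value I x"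
    using x by (simp add: lp_optimal_def)
  moreover have "lp_value I y = throughput I K"
    unfolding lp_value_def throughput_def
    by (rule sum.mono_neutral_cong_right) (use sub in \<open>auto simp: y_def\<close>)
  ultimately show ?thesis
    by simp
qed

lemma max_throughput_le_lp_value:
  assumes I: "anf_instance I" and x: "lp_optimal I x"
  shows "max_throughput I \<le> lp_value I x"
proof -
  let ?T = "{throughput I K | K g. anf_solution I K g \<and> (\<forall>e\<in>edges I. load K g e \<le> cap I e)}"
  \<comment> \<open>The throughput depends on \<open>K\<close> alone, so infinitely many flows yield
    only finitely many values.\<close>
  have "?T \<subseteq> throughput I ` Pow {1..ncom I}"
    by (auto simp: anf_solution_def)
  then have "finite ?T"
    by (rule finite_subset) simp
  moreover have "throughput I {} \<in> ?T"
  proof -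
    have "anf_solution I {} (\<lambda>_ _. 0)" "\<forall>e\<in>edges I. load {} (\<lambda>_ _. 0) e \<le> cap I e"
      using I by (simp_all add: anf_solution_def load_def anf_instance_def less_imp_le)
    then show ?thesis
      by blast
  qed
  then have "?T \<noteq> {}"
    by blast
  ultimately show ?thesis
    unfolding max_throughput_def using throughput_le_lp_value[OF I x] by (intro Max.boundedI) blast+
qed

text \<open>Here the standing assumption enters: routing one commodity alone is already a solution
  within the capacities.\<close>

lemma w_max_le_lp_value:
  assumes I: "anf_instance I" and x: "lp_optimal I x" and k: "1 \<le> ncom I"
  shows "w_max I \<le> lp_value I x"
proof -
  have "wt I i \<le> lp_value I x" if i: "i \<in> {1..ncom I}" for i
  proof -
    obtain g where "st_flow (net I) (src I i) (snk I i) (dem I i) g" "\<forall>e\<in>edges I. g e \<le> cap I e"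
      using I i unfolding anf_instance_def by blast
    then show ?thesis
      using throughput_le_lp_value[OF I x, of "{i}" "\<lambda>_. g"] i
      by (simp add: anf_solution_def load_def throughput_def)
  qed
  then show ?thesis
    using k by (simp add: w_max_def)
qed

section \<open>The estimator\<close>

lemma lp_feasible_amount:
  "lp_feasible I x \<Longrightarrow> j \<in> {1..ncom I} \<Longrightarrow> 0 \<le> amount x j \<and> amount x j \<le> 1"
  by (simp add: lp_feasible_def)

section \<open>Closed forms of the conditional expectations\<close>

text \<open>The moment generating function at \<theta> of \<open>a\<close> times the
  \<open>j\<close>-th variable, which is constant for \<open>j \<le> i\<close> and Bernoulli
  otherwise.\<close>

definition factor :: "'v frac_solution \<Rightarrow> (nat \<Rightarrow> bool) \<Rightarrow> nat \<Rightarrow> real \<Rightarrow> nat \<Rightarrow> real \<Rightarrow> real" where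
  "factor x z i \<theta> j a =
     (if j \<le> i then if z j then exp (\<theta> * a) else 1
      else 1 - amount x j + amount x j * exp (\<theta> * a))"

lemma expectation_factor:
  assumes "j \<in> {1..ncom I}" "0 \<le> amount x j" "amount x j \<le> 1"
  shows "measure_pmf.expectation (Z_law I x z i) (\<lambda>Z. exp (\<theta> * of_bool (Z j) * a)) =
    factor x z i \<theta> j a"
proof -
  have "measure_pmf.expectation (Z_law I x z i) (\<lambda>Z. exp (\<theta> * of_bool (Z j) * a)) =
      measure_pmf.expectation (map_pmf (\<lambda>Z. Z j) (Z_law I x z i)) (\<lambda>y. exp (\<theta> * of_bool y * a))"
    by simp
  also have "map_pmf (\<lambda>Z. Z j) (Z_law I x z i) =
      (if j \<le> i then return_pmf (z j) else bernoulli_pmf (amount x j))"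
    unfolding Z_law_def using assms(1) by (subst Pi_pmf_component) auto
  also have "measure_pmf.expectation \<dots> (\<lambda>y. exp (\<theta> * of_bool y * a)) = factor x z i \<theta> j a"
    using assms(2,3) by (auto simp: factor_def)
  finally show ?thesis .
qed

definition alpha_const :: "'v anf_instance \<Rightarrow> 'v frac_solution \<Rightarrow> real" where
  "alpha_const I x =
     exp (- theta_alpha (num_edges I) * (1 - delta_alpha (num_edges I)) * mu_tilde I x)"

definition beta_const :: "'v anf_instance \<Rightarrow> real" where
  "beta_const I = exp (- theta_beta (num_edges I) * (1 + delta_beta (num_edges I)) * mu_hat)"

text \<open>The fraction of the capacity of \<open>e\<close> that commodity \<open>i\<close>
  occupies once it is routed. It is 0 if \<open>amount x i = 0\<close>, by division by zero.\<close>

definition share :: "'v anf_instance \<Rightarrow> 'v frac_solution \<Rightarrow> 'v \<times> 'v \<Rightarrow> nat \<Rightarrow> real" where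
  "share I x e i = dem I i * eflow x i e / (amount x i * cap I e)"

definition alpha_val :: "'v anf_instance \<Rightarrow> 'v frac_solution \<Rightarrow> (nat \<Rightarrow> bool) \<Rightarrow> nat \<Rightarrow> real" where
  "alpha_val I x z i =
     alpha_const I x * (\<Prod>j\<in>{1..ncom I}. factor x z i (theta_alpha (num_edges I)) j (wt I j / w_max I))"

definition beta_val ::
  "'v anf_instance \<Rightarrow> 'v frac_solution \<Rightarrow> 'v \<times> 'v \<Rightarrow> (nat \<Rightarrow> bool) \<Rightarrow> nat \<Rightarrow> real" where
  "beta_val I x e z i =
     beta_const I * (\<Prod>j\<in>{1..ncom I}. factor x z i (theta_beta (num_edges I)) j (share I x e j))"

lemma Ex_est_eq:
  assumes feas: "lp_feasible I x"
  shows "Ex_est I x z i = alpha_val I x z i + (\<Sum>e\<in>edges I. beta_val I x e z i)"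
proof -
  have "est_alpha I x (Z_law I x z i) = alpha_val I x z i"
    unfolding est_alpha_def alpha_val_def alpha_const_def times_divide_eq_right[symmetric]
    by (intro arg_cong2[where f = "(*)"] prod.cong refl expectation_factor)
      (use lp_feasible_amount[OF feas] in auto)
  moreover have "est_beta I x e (Z_law I x z i) = beta_val I x e z i" for e
    unfolding est_beta_def beta_val_def beta_const_def share_def
    by (intro arg_cong2[where f = "(*)"] prod.cong refl expectation_factor)
      (use lp_feasible_amount[OF feas] in auto)
  ultimately show ?thesis
    by (simp add: Ex_est_def est_def)
qed

section \<open>Monotonicity of the estimator along the rounds\<close>

text \<open>Fixing variable \<open>Suc i\<close> changes only its own factor, and the Bernoulli
  factor is the average of the two fixed ones.\<close>

lemma prod_factor_average:
  assumes "Suc i \<in> A" "finite A"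
  shows "(\<Prod>j\<in>A. factor x z i \<theta> j (a j)) =
    (1 - amount x (Suc i)) * (\<Prod>j\<in>A. factor x (z(Suc i := False)) (Suc i) \<theta> j (a j)) +
    amount x (Suc i) * (\<Prod>j\<in>A. factor x (z(Suc i := True)) (Suc i) \<theta> j (a j))"
proof -
  let ?P = "\<Prod>j\<in>A - {Suc i}. factor x z i \<theta> j (a j)"
  have "(\<Prod>j\<in>A - {Suc i}. factor x (z(Suc i := b)) (Suc i) \<theta> j (a j)) = ?P" for b
    by (rule prod.cong) (auto simp: factor_def)
  then have "(\<Prod>j\<in>A. factor x (z(Suc i := b)) (Suc i) \<theta> j (a j)) =
      factor x (z(Suc i := b)) (Suc i) \<theta> (Suc i) (a (Suc i)) * ?P" for b
    by (simp add: prod.remove[OF assms(2,1)])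
  moreover have "(\<Prod>j\<in>A. factor x z i \<theta> j (a j)) = factor x z i \<theta> (Suc i) (a (Suc i)) * ?P"
    by (rule prod.remove[OF assms(2,1)])
  ultimately show ?thesis
    by (simp add: factor_def algebra_simps)
qed

lemma Ex_est_average:
  assumes feas: "lp_feasible I x" and i: "Suc i \<le> ncom I"
  shows "Ex_est I x z i =
    (1 - amount x (Suc i)) * Ex_est I x (z(Suc i := False)) (Suc i) +
    amount x (Suc i) * Ex_est I x (z(Suc i := True)) (Suc i)"
proof -
  have *: "c * (\<Prod>j\<in>{1..ncom I}. factor x z i \<theta> j (a j)) =
    (1 - amount x (Suc i)) * (c * (\<Prod>j\<in>{1..ncom I}. factor x (z(Suc i := False)) (Suc i) \<theta> j (a j))) +
    amount x (Suc i) * (c * (\<Prod>j\<in>{1..ncom I}. factor x (z(Suc i := True)) (Suc i) \<theta> j (a j)))" for c \<theta> a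
    by (subst prod_factor_average[of i]) (use i in \<open>simp_all add: algebra_simps\<close>)
  have "alpha_val I x z i =
      (1 - amount x (Suc i)) * alpha_val I x (z(Suc i := False)) (Suc i) +
      amount x (Suc i) * alpha_val I x (z(Suc i := True)) (Suc i)"
    unfolding alpha_val_def by (rule *)
  moreover have "beta_val I x e z i =
      (1 - amount x (Suc i)) * beta_val I x e (z(Suc i := False)) (Suc i) +
      amount x (Suc i) * beta_val I x e (z(Suc i := True)) (Suc i)" for e
    unfolding beta_val_def by (rule *)
  then have "(\<Sum>e\<in>edges I. beta_val I x e z i) =
      (1 - amount x (Suc i)) * (\<Sum>e\<in>edges I. beta_val I x e (z(Suc i := False)) (Suc i)) +
      amount x (Suc i) * (\<Sum>e\<in>edges I. beta_val I x e (z(Suc i := True)) (Suc i))"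
    by (simp only: sum.distrib sum_distrib_left)
  ultimately show ?thesis
    by (simp only: Ex_est_eq[OF feas] distrib_left add.assoc add.left_commute)
qed

abbreviation "choices I x i \<equiv> fst (derand I x i)"

text \<open>The loop invariant that allows the stored value \<open>F\<close> to be eliminated in
  favour of the choices.\<close>

lemma snd_derand: "snd (derand I x i) = Ex_est I x (choices I x i) i"
  by (cases i) (auto simp: Let_def split: prod.splits)

lemma choices_Suc:
  "choices I x (Suc i) = (choices I x i)(Suc i :=
    \<not> (amount x (Suc i) = 0 \<or>
       Ex_est I x ((choices I x i)(Suc i := False)) (Suc i) < Ex_est I x (choices I x i) i))"
  by (simp add: Let_def case_prod_beta snd_derand)

declare derand.simps(2)[simp del]

text \<open>Makes the division by \<open>amount x i\<close> in \<open>rounded\<close> meaningful,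
  and confines routed commodities to the indices already processed.\<close>

lemma choices_True:
  "choices I x i j \<Longrightarrow> amount x j \<noteq> 0 \<and> 1 \<le> j \<and> j \<le> i"
proof (induction i)
  case (Suc i)
  then show ?case
    by (cases "j = Suc i") (auto simp: choices_Suc)
qed simp

text \<open>If the choice 0 does not lower the value, the average forces the choice 1 not to raise
  it, provided its probability is positive. With probability zero the average is the value for
  choice 0 itself.\<close>

lemma Ex_est_choices_Suc_le:
  assumes feas: "lp_feasible I x" and i: "Suc i \<le> ncom I"
  shows "Ex_est I x (choices I x (Suc i)) (Suc i) \<le> Ex_est I x (choices I x i) i"
proof -
  let ?z = "choices I x i" and ?p = "amount x (Suc i)"
  let ?F = "Ex_est I x ?z i" and ?Fno = "Ex_est I x (?z(Suc i := False)) (Suc i)"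
    and ?Fyes = "Ex_est I x (?z(Suc i := True)) (Suc i)"
  have avg: "?F = (1 - ?p) * ?Fno + ?p * ?Fyes"
    using Ex_est_average[OF feas i] by blast
  have p: "0 \<le> ?p" "?p \<le> 1"
    using lp_feasible_amount[OF feas, of "Suc i"] i by auto
  consider "?p = 0" | "?Fno < ?F" | "?p \<noteq> 0" "\<not> ?Fno < ?F"
    by blast
  then show ?thesis
  proof cases
    case 1
    then show ?thesis
      using avg by (simp add: choices_Suc)
  next
    case 2
    then show ?thesis
      by (simp add: choices_Suc)
  next
    case 3
    then have "(1 - ?p) * ?F \<le> (1 - ?p) * ?Fno"
      using p by (intro mult_left_mono) auto
    then have "(1 - ?p) * ?F \<le> ?F - ?p * ?Fyes"
      using avg by linarith
    then have "?p * ?Fyes \<le> ?p * ?F"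
      by (simp add: left_diff_distrib)
    then show ?thesis
      using 3 p by (simp add: choices_Suc)
  qed
qed

lemma Ex_est_choices_le:
  assumes feas: "lp_feasible I x" and "i \<le> ncom I"
  shows "Ex_est I x (choices I x i) i \<le> Ex_est I x (\<lambda>_. False) 0"
  using assms(2)
proof (induction i)
  case (Suc i)
  then show ?case
    using Ex_est_choices_Suc_le[OF feas, of i] by simp
qed simp

section \<open>Chernoff-type inequalities\<close>

text \<open>Convexity on the segment between 0 and \<theta>. The bound is linear in
  \<open>a\<close>, so only expectations enter the later estimates.\<close>

lemma exp_le_chord:
  fixes a \<theta> :: real
  assumes "0 \<le> a" "a \<le> 1"
  shows "exp (\<theta> * a) \<le> 1 + a * (exp \<theta> - 1)"
  using convex_onD[OF exp_convex assms, of 0 \<theta>] by (simp add: algebra_simps)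

text \<open>The chord bound followed by \<open>1 + y \<le> exp y\<close>. The sign of \<theta> is
  arbitrary, so both the lower and the upper tail are covered.\<close>

lemma prod_factor_le:
  assumes "\<And>j. j \<in> A \<Longrightarrow> 0 \<le> amount x j \<and> amount x j \<le> 1" "\<And>j. j \<in> A \<Longrightarrow> 0 \<le> a j \<and> a j \<le> 1"
    and "\<And>j. j \<in> A \<Longrightarrow> i < j"
  shows "(\<Prod>j\<in>A. factor x z i \<theta> j (a j)) \<le> exp ((exp \<theta> - 1) * (\<Sum>j\<in>A. amount x j * a j))"
proof -
  have "(\<Prod>j\<in>A. factor x z i \<theta> j (a j)) \<le> (\<Prod>j\<in>A. exp ((exp \<theta> - 1) * (amount x j * a j)))"
  proof (rule prod_mono, intro conjI)
    fix j assume j: "j \<in> A"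
    have eq: "factor x z i \<theta> j (a j) = 1 - amount x j + amount x j * exp (\<theta> * a j)"
      using assms(3)[OF j] by (simp add: factor_def)
    show "0 \<le> factor x z i \<theta> j (a j)"
      using assms(1)[OF j] by (simp add: eq)
    have "amount x j * exp (\<theta> * a j) \<le> amount x j * (1 + a j * (exp \<theta> - 1))"
      using assms(1,2)[OF j] by (intro mult_left_mono exp_le_chord) auto
    then have "factor x z i \<theta> j (a j) \<le> 1 + (exp \<theta> - 1) * (amount x j * a j)"
      by (simp add: eq algebra_simps)
    also have "\<dots> \<le> exp ((exp \<theta> - 1) * (amount x j * a j))"
      by (rule exp_ge_add_one_self)
    finally show "factor x z i \<theta> j (a j) \<le> exp ((exp \<theta> - 1) * (amount x j * a j))" .
  qed
  also have "\<dots> = exp ((exp \<theta> - 1) * (\<Sum>j\<in>A. amount x j * a j))"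
    by (cases "finite A") (simp_all add: exp_sum sum_distrib_left)
  finally show ?thesis .
qed

text \<open>With all variables fixed, the summands of the estimator become exponentials of realized
  sums.\<close>

lemma prod_factor_fixed:
  assumes "\<And>j. j \<in> A \<Longrightarrow> j \<le> i" "finite A"
  shows "(\<Prod>j\<in>A. factor x z i \<theta> j (a j)) = exp (\<theta> * (\<Sum>j | j \<in> A \<and> z j. a j))"
proof -
  have "(\<Prod>j\<in>A. factor x z i \<theta> j (a j)) = (\<Prod>j\<in>A. exp (\<theta> * (if z j then a j else 0)))"
    using assms(1) by (intro prod.cong) (auto simp: factor_def)
  also have "\<dots> = exp (\<theta> * (\<Sum>j\<in>A. if z j then a j else 0))"
    using assms(2) by (simp add: exp_sum sum_distrib_left)
  also have "(\<Sum>j\<in>A. if z j then a j else 0) = (\<Sum>j | j \<in> A \<and> z j. a j)"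
    using assms(2) by (simp add: sum.inter_filter)
  finally show ?thesis .
qed

text \<open>The difference of the two sides vanishes at 0 and has derivative
  \<open>- ln (1 - t) - t\<close>, which is nonnegative. This yields the exponent \<delta>^2 / 2 of
  the lower tail.\<close>

lemma mult_ln_lower_bound:
  fixes \<delta> :: real
  assumes "0 \<le> \<delta>" "\<delta> < 1"
  shows "\<delta>\<^sup>2 / 2 - \<delta> \<le> (1 - \<delta>) * ln (1 - \<delta>)"
proof -
  let ?f = "\<lambda>t. (1 - t) * ln (1 - t) + t - t\<^sup>2 / 2"
  have "?f 0 \<le> ?f \<delta>"
  proof (rule DERIV_nonneg_imp_nondecreasing[OF assms(1)])
    fix t :: real assume t: "0 \<le> t" "t \<le> \<delta>"
    then have "t < 1"
      using assms by simp
    then have "(?f has_real_derivative (- ln (1 - t) - t)) (at t)"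
      by (auto intro!: derivative_eq_intros simp: divide_simps)
    moreover have "0 \<le> - ln (1 - t) - t"
      using ln_le_minus_one[of "1 - t"] \<open>t < 1\<close> by simp
    ultimately show "\<exists>y. (?f has_real_derivative y) (at t) \<and> 0 \<le> y"
      by blast
  qed
  then show ?thesis
    by simp
qed

text \<open>The key is \<open>ln (u / c) \<le> u / c - 1\<close> for \<open>u = ln L\<close>.\<close>

lemma Chernoff_exponent_le:
  fixes c L :: real
  assumes "0 < c" "1 < L"
  defines "B \<equiv> c * L / ln L"
  shows "B - B * ln B \<le> (1 - c) * L"
proof -
  have u: "0 < ln L" and L: "0 < L"
    using assms by simp_all
  have "ln (ln L / c) \<le> ln L / c - 1"
    using u assms by (intro ln_le_minus_one) simp
  moreover have "ln B = ln c + ln L - ln (ln L)"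
    using u L assms by (simp add: B_def ln_div ln_mult)
  moreover have "ln (ln L / c) = ln (ln L) - ln c"
    using u assms by (simp add: ln_div)
  ultimately have "1 - ln B \<le> ln L / c - ln L"
    by simp
  moreover have "0 \<le> B"
    using u L assms by (simp add: B_def)
  ultimately have "B * (1 - ln B) \<le> B * (ln L / c - ln L)"
    by (rule mult_left_mono)
  also have "\<dots> = (1 - c) * L"
    using u assms by (simp add: B_def field_simps)
  finally show ?thesis
    by (simp add: algebra_simps)
qed


section \<open>The initial value of the estimator\<close>

lemma w_max_bounds:
  assumes "anf_instance I" "j \<in> {1..ncom I}"
  shows "wt I j \<le> w_max I" "0 < wt I j" "0 < w_max I"
proof -
  show "wt I j \<le> w_max I"
    unfolding w_max_def using assms(2) by (intro Max_ge) auto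
  moreover show "0 < wt I j"
    using assms unfolding anf_instance_def by blast
  ultimately show "0 < w_max I"
    by simp
qed

text \<open>The LP constraint on single commodities keeps the shares in the unit interval, as the
  chord bound requires; the last bound links their mean to the joint capacity constraint.\<close>

lemma share_bounds:
  assumes I: "anf_instance I" and x: "lp_feasible I x" and j: "j \<in> {1..ncom I}" and e: "e \<in> edges I"
  shows "0 \<le> share I x e j" "share I x e j \<le> 1"
    "amount x j * share I x e j \<le> eflow x j e * dem I j / cap I e"
proof -
  have cap: "0 < cap I e" and dem: "0 < dem I j"
    using I e j unfolding anf_instance_def by blast+
  have f: "0 \<le> eflow x j e" "eflow x j e * dem I j \<le> amount x j * cap I e" "0 \<le> amount x j"
    using x e j unfolding lp_feasible_def by blast+
  show "0 \<le> share I x e j"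
    using cap dem f by (simp add: share_def)
  show "share I x e j \<le> 1"
    using cap f by (cases "amount x j = 0") (auto simp: share_def field_simps order_less_le)
  show "amount x j * share I x e j \<le> eflow x j e * dem I j / cap I e"
    using cap dem f by (cases "amount x j = 0") (auto simp: share_def field_simps)
qed

text \<open>Lower tail: \<open>exp \<theta> - 1 = - \<delta>\<close> for \<theta> =
  \<open>ln (1 - \<delta>)\<close>, so the total exponent is
  \<open>- \<mu> * (\<delta> + (1 - \<delta>) * ln (1 - \<delta>))\<close>.\<close>

lemma alpha_val_0_le:
  assumes I: "anf_instance I" and x: "lp_optimal I x" and k: "1 \<le> ncom I" and m: "2 \<le> num_edges I"
  shows "alpha_val I x z 0 \<le> exp (- (1 / (2 * (real (num_edges I))\<^sup>2)))"
proof -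
  define \<delta> where "\<delta> = delta_alpha (num_edges I)"
  define \<mu> where "\<mu> = mu_tilde I x"
  have feas: "lp_feasible I x"
    using x by (simp add: lp_optimal_def)
  have \<delta>: "0 \<le> \<delta>" "\<delta> < 1"
    using m by (auto simp: \<delta>_def delta_alpha_def)
  have wm: "0 < w_max I"
    using w_max_bounds(3)[OF I, of 1] k by simp
  have \<mu>: "1 \<le> \<mu>"
    using w_max_le_lp_value[OF I x k] wm by (simp add: \<mu>_def mu_tilde_def)
  have sum: "(\<Sum>j\<in>{1..ncom I}. amount x j * (wt I j / w_max I)) = \<mu>"
    by (simp add: \<mu>_def mu_tilde_def lp_value_def sum_divide_distrib mult.commute)
  have "(\<Prod>j\<in>{1..ncom I}. factor x z 0 (ln (1 - \<delta>)) j (wt I j / w_max I)) \<le>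
      exp ((exp (ln (1 - \<delta>)) - 1) * (\<Sum>j\<in>{1..ncom I}. amount x j * (wt I j / w_max I)))"
    using lp_feasible_amount[OF feas] w_max_bounds[OF I]
    by (intro prod_factor_le) (auto simp: less_imp_le)
  also have "\<dots> = exp (- \<delta> * \<mu>)"
    unfolding sum using \<delta> by simp
  finally have "alpha_val I x z 0 \<le> exp (- ln (1 - \<delta>) * (1 - \<delta>) * \<mu>) * exp (- \<delta> * \<mu>)"
    unfolding alpha_val_def alpha_const_def theta_alpha_def \<delta>_def[symmetric] \<mu>_def[symmetric]
    by (intro mult_left_mono) auto
  also have "\<dots> = exp (- (\<mu> * (\<delta> + (1 - \<delta>) * ln (1 - \<delta>))))"
    by (simp add: exp_add[symmetric] algebra_simps)
  also have "\<dots> \<le> exp (- (\<delta>\<^sup>2 / 2))"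
  proof -
    have "1 * (\<delta>\<^sup>2 / 2) \<le> \<mu> * (\<delta> + (1 - \<delta>) * ln (1 - \<delta>))"
      using mult_ln_lower_bound[OF \<delta>] \<mu> by (intro mult_mono) auto
    then show ?thesis
      by simp
  qed
  finally show ?thesis
    by (simp add: \<delta>_def delta_alpha_def power_divide mult.commute)
qed

lemma ln_gt_1:
  assumes "9 \<le> m"
  shows "1 < ln (real m)"
proof -
  have "exp 1 < real m"
    using e_less_272 assms by linarith
  then show ?thesis
    using ln_less_cancel_iff[of "exp 1" "real m"] assms by simp
qed

text \<open>The inequality \<open>ln y \<le> y - 1\<close> at \<open>y = ln m\<close> shows that
  \<open>ln m / ln (ln m)\<close> is at least 1. In particular \<open>theta_beta m\<close> is
  positive.\<close>

lemma delta_beta_ge: "9 \<le> m \<Longrightarrow> 3 * b_const \<le> 1 + delta_beta m"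
proof -
  assume "9 \<le> m"
  from ln_gt_1[OF this] have L: "1 < ln (real m)" .
  then have "0 < ln (ln (real m))" "ln (ln (real m)) \<le> ln (real m)"
    using ln_le_minus_one[of "ln (real m)"] by auto
  then show ?thesis
    using L by (simp add: delta_beta_def b_const_def field_simps)
qed

lemma beta_val_0_le:
  assumes I: "anf_instance I" and feas: "lp_feasible I x" and m: "9 \<le> num_edges I" and e: "e \<in> edges I"
  shows "beta_val I x e z 0 \<le> 1 / real (num_edges I) ^ 4"
proof -
  define L where "L = ln (real (num_edges I))"
  define B where "B = 1 + delta_beta (num_edges I)"
  have L: "1 < L"
    using ln_gt_1[OF m] by (simp add: L_def)
  have B_eq: "B = 3 * b_const * L / ln L"
    by (simp add: B_def L_def delta_beta_def)
  have B: "1 \<le> B"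
    using delta_beta_ge[OF m] by (simp add: B_def b_const_def)
  have cap: "0 < cap I e"
    using I e unfolding anf_instance_def by blast
  have "(\<Sum>j\<in>{1..ncom I}. amount x j * share I x e j) \<le>
      (\<Sum>j\<in>{1..ncom I}. eflow x j e * dem I j / cap I e)"
    using share_bounds(3)[OF I feas _ e] by (intro sum_mono)
  also have "\<dots> \<le> 1"
    using feas e cap by (simp add: lp_feasible_def sum_divide_distrib[symmetric])
  \<comment> \<open>The mean relative load is at most \<open>mu_hat = 1\<close>, by the joint
    capacity constraint.\<close>
  finally have S: "(\<Sum>j\<in>{1..ncom I}. amount x j * share I x e j) \<le> 1" .
  have "(\<Prod>j\<in>{1..ncom I}. factor x z 0 (ln B) j (share I x e j)) \<le>
      exp ((exp (ln B) - 1) * (\<Sum>j\<in>{1..ncom I}. amount x j * share I x e j))"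
    using lp_feasible_amount[OF feas] share_bounds[OF I feas _ e] by (intro prod_factor_le) auto
  also have "\<dots> \<le> exp ((B - 1) * 1)"
    unfolding exp_le_cancel_iff using S B by (simp add: mult_left_le)
  finally have "beta_val I x e z 0 \<le> exp (- ln B * B * 1) * exp ((B - 1) * 1)"
    unfolding beta_val_def beta_const_def theta_beta_def mu_hat_def B_def[symmetric]
    by (intro mult_left_mono) auto
  also have "\<dots> = exp (B - B * ln B - 1)"
    by (simp add: exp_add[symmetric] algebra_simps)
  \<comment> \<open>Here \<open>c = 3 * b_const = 5.55\<close>, so the exponent is at most
    \<open>- 4.55 * L - 1\<close>.\<close>
  also have "\<dots> \<le> exp (- 4 * L)"
    using Chernoff_exponent_le[of "3 * b_const" L] L unfolding B_eq exp_le_cancel_iff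
    by (simp add: b_const_def algebra_simps)
  also have "\<dots> = 1 / real (num_edges I) ^ 4"
  proof -
    have "exp (4 * L) = exp L ^ 4"
      by (simp add: exp_of_nat_mult[symmetric])
    also have "exp L = real (num_edges I)"
      using m by (simp add: L_def)
    finally show ?thesis
      by (simp add: exp_minus inverse_eq_divide)
  qed
  finally show ?thesis .
qed

text \<open>The first summand falls short of 1 by about \<open>1 / (2 * M^2)\<close>, while the
  \<open>M\<close> edges together contribute only \<open>1 / M^3\<close>, at most
  \<open>1 / (9 * M^2)\<close>.\<close>

lemma Ex_est_0_less_1:
  assumes I: "anf_instance I" and x: "lp_optimal I x" and k: "1 \<le> ncom I" and m: "9 \<le> num_edges I"
  shows "Ex_est I x z 0 < 1"
proof -
  define M where "M = real (num_edges I)"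
  have M: "9 \<le> M"
    using m by (simp add: M_def)
  have feas: "lp_feasible I x"
    using x by (simp add: lp_optimal_def)
  have "Ex_est I x z 0 \<le> exp (- (1 / (2 * M\<^sup>2))) + (\<Sum>e\<in>edges I. 1 / M ^ 4)"
    unfolding Ex_est_eq[OF feas] M_def
    using alpha_val_0_le[OF I x k] beta_val_0_le[OF I feas m] m by (intro add_mono sum_mono) auto
  also have "(\<Sum>e\<in>edges I. 1 / M ^ 4) = 1 / M ^ 3"
    using M by (simp add: M_def[symmetric] power_eq_if)
  also have "\<dots> \<le> 1 / (9 * M\<^sup>2)"
    using M by (simp add: frac_le power_eq_if)
  also have "exp (- (1 / (2 * M\<^sup>2))) \<le> 1 / (1 + 1 / (2 * M\<^sup>2))"
    using exp_ge_add_one_self[of "1 / (2 * M\<^sup>2)"]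
    by (simp add: exp_minus inverse_eq_divide frac_le add_pos_nonneg)
  also have "1 / (1 + 1 / (2 * M\<^sup>2)) + 1 / (9 * M\<^sup>2) < 1"
  proof -
    have "1 / (1 + 1 / (2 * q)) + 1 / (9 * q) < 1" if "1 < q" for q :: real
    proof -
      \<comment> \<open>With \<open>q = M^2\<close>: the gap \<open>1 / (2 * q + 1)\<close> exceeds
        \<open>1 / (9 * q)\<close> because \<open>2 * q + 1 < 9 * q\<close>.\<close>
      have "1 / (1 + 1 / (2 * q)) = 1 - 1 / (2 * q + 1)" "1 / (9 * q) < 1 / (2 * q + 1)"
        using that by (simp_all add: divide_simps)
      then show ?thesis
        by simp
    qed
    moreover have "1 < M\<^sup>2"
      using M by (intro one_less_power) auto
    ultimately show ?thesis
      by blast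
  qed
  finally show ?thesis
    by simp
qed

section \<open>Guarantees for the final choices\<close>

lemma factor_nonneg:
  assumes "0 \<le> amount x j" "amount x j \<le> 1"
  shows "0 \<le> factor x z i \<theta> j a"
  using assms by (simp add: factor_def)

lemma val_nonneg:
  assumes feas: "lp_feasible I x"
  shows "0 \<le> alpha_val I x z i" "0 \<le> beta_val I x e z i"
  unfolding alpha_val_def beta_val_def alpha_const_def beta_const_def
  using lp_feasible_amount[OF feas] by (auto intro!: mult_nonneg_nonneg prod_nonneg factor_nonneg)

text \<open>Each summand below 1 has a negative exponent, \<theta> times the deviation. A negative
  \<open>theta_alpha\<close> turns this into a lower bound on the weight, a positive
  \<open>theta_beta\<close> into an upper bound on the load.\<close>

lemma choices_guarantee:
  assumes I: "anf_instance I" and x: "lp_optimal I x" and k: "1 \<le> ncom I" and m: "9 \<le> num_edges I"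
  defines "z \<equiv> choices I x (ncom I)"
  shows "(1 - 1 / real (num_edges I)) * lp_value I x \<le> (\<Sum>j | j \<in> {1..ncom I} \<and> z j. wt I j)"
    and "\<And>e. e \<in> edges I \<Longrightarrow>
      (\<Sum>j | j \<in> {1..ncom I} \<and> z j. share I x e j) \<le> 1 + delta_beta (num_edges I)"
proof -
  have feas: "lp_feasible I x"
    using x by (simp add: lp_optimal_def)
  \<comment> \<open>An infinite set has cardinality 0.\<close>
  have fin: "finite (edges I)"
    using m by (intro card_ge_0_finite) simp
  have lt: "alpha_val I x z (ncom I) + (\<Sum>e\<in>edges I. beta_val I x e z (ncom I)) < 1"
    using Ex_est_choices_le[OF feas, of "ncom I"] Ex_est_0_less_1[OF I x k m, of "\<lambda>_. False"]
    by (simp add: Ex_est_eq[OF feas] z_def)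
  let ?S = "{j. j \<in> {1..ncom I} \<and> z j}"
  show "(1 - 1 / real (num_edges I)) * lp_value I x \<le> (\<Sum>j\<in>?S. wt I j)"
  proof -
    define \<delta> where "\<delta> = delta_alpha (num_edges I)"
    have \<delta>: "0 < \<delta>" "\<delta> < 1"
      using m by (auto simp: \<delta>_def delta_alpha_def)
    have wm: "0 < w_max I"
      using w_max_bounds(3)[OF I, of 1] k by simp
    have "alpha_val I x z (ncom I) < 1"
      using lt sum_nonneg[of "edges I" "\<lambda>e. beta_val I x e z (ncom I)"] val_nonneg(2)[OF feas] by force
    moreover have "alpha_val I x z (ncom I) =
        exp (ln (1 - \<delta>) * ((\<Sum>j\<in>?S. wt I j / w_max I) - (1 - \<delta>) * mu_tilde I x))"
      unfolding alpha_val_def alpha_const_def theta_alpha_def \<delta>_def[symmetric]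
      by (subst prod_factor_fixed) (auto simp: exp_add[symmetric] algebra_simps)
    ultimately have "ln (1 - \<delta>) * ((\<Sum>j\<in>?S. wt I j / w_max I) - (1 - \<delta>) * mu_tilde I x) < 0"
      by simp
    moreover have "ln (1 - \<delta>) < 0"
      using \<delta> by simp
    ultimately have "(1 - \<delta>) * mu_tilde I x < (\<Sum>j\<in>?S. wt I j / w_max I)"
      by (simp add: mult_less_0_iff)
    then have "((1 - \<delta>) * lp_value I x) / w_max I < (\<Sum>j\<in>?S. wt I j) / w_max I"
      by (simp add: mu_tilde_def sum_divide_distrib)
    then have "(1 - \<delta>) * lp_value I x < (\<Sum>j\<in>?S. wt I j)"
      using wm by (simp add: divide_less_cancel)
    then show ?thesis
      by (simp add: \<delta>_def delta_alpha_def)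
  qed
  show "(\<Sum>j\<in>?S. share I x e j) \<le> 1 + delta_beta (num_edges I)" if e: "e \<in> edges I" for e
  proof -
    define B where "B = 1 + delta_beta (num_edges I)"
    have B: "1 < B"
      using delta_beta_ge[OF m] by (simp add: B_def b_const_def)
    have "beta_val I x e z (ncom I) < 1"
    proof -
      have "beta_val I x e z (ncom I) \<le> (\<Sum>e\<in>edges I. beta_val I x e z (ncom I))"
        using fin val_nonneg(2)[OF feas] by (intro member_le_sum e) auto
      then show ?thesis
        using lt val_nonneg(1)[OF feas, of z "ncom I"] by linarith
    qed
    moreover have "beta_val I x e z (ncom I) = exp (ln B * ((\<Sum>j\<in>?S. share I x e j) - B))"
      unfolding beta_val_def beta_const_def theta_beta_def mu_hat_def B_def[symmetric]
      by (subst prod_factor_fixed) (auto simp: exp_add[symmetric] algebra_simps)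
    ultimately have "ln B * ((\<Sum>j\<in>?S. share I x e j) - B) < 0"
      by simp
    then show ?thesis
      using B by (simp add: mult_less_0_iff B_def)
  qed
qed

section \<open>The rounded solution\<close>

lemma rounded_simps:
  "amount (rounded I x) i = of_bool (choices I x (ncom I) i)"
  "eflow (rounded I x) i e =
     (if choices I x (ncom I) i \<and> e \<in> edges I then eflow x i e / amount x i else 0)"
  by (simp_all add: rounded_def Let_def)

lemma routed_rounded: "routed I (rounded I x) = {j. j \<in> {1..ncom I} \<and> choices I x (ncom I) j}"
  by (auto simp: routed_def rounded_simps)

text \<open>The routed flow is the LP flow scaled by \<open>dem I i / amount x i\<close>.
  Conservation is preserved, and as no LP flow enters the source, its net outflow becomes the
  demand.\<close>

lemma anf_solution_rounded:
  assumes I: "anf_instance I" and feas: "lp_feasible I x"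
  shows "anf_solution I (routed I (rounded I x)) (flow_of I (rounded I x))"
  unfolding anf_solution_def
proof (intro conjI ballI)
  fix i assume "i \<in> routed I (rounded I x)"
  then have i: "i \<in> {1..ncom I}" and z: "choices I x (ncom I) i"
    by (auto simp: routed_rounded)
  have p: "0 < amount x i"
    using choices_True[OF z] lp_feasible_amount[OF feas i] by simp
  have dem: "0 < dem I i"
    using I i unfolding anf_instance_def by blast
  have flow: "flow_of I (rounded I x) i e = dem I i / amount x i * eflow x i e" if "e \<in> edges I" for e
    using that z by (simp add: flow_of_def rounded_simps)
  have sums: "(\<Sum>e\<in>out_arcs (with_proj (net I)) v. flow_of I (rounded I x) i e) =
      dem I i / amount x i * (\<Sum>e\<in>out_arcs (with_proj (net I)) v. eflow x i e)"
    "(\<Sum>e\<in>in_arcs (with_proj (net I)) v. flow_of I (rounded I x) i e) =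
      dem I i / amount x i * (\<Sum>e\<in>in_arcs (with_proj (net I)) v. eflow x i e)" for v
    unfolding sum_distrib_left
    by (rule sum.cong; simp add: out_arcs_pair in_arcs_pair flow)+
  have lp: "(\<Sum>e\<in>out_arcs (with_proj (net I)) (src I i). eflow x i e) = amount x i"
    "\<forall>v\<in>pverts (net I) - {src I i, snk I i}.
      (\<Sum>e\<in>in_arcs (with_proj (net I)) v. eflow x i e) = (\<Sum>e\<in>out_arcs (with_proj (net I)) v. eflow x i e)"
    "\<forall>e\<in>edges I. 0 \<le> eflow x i e"
    "\<forall>e\<in>in_arcs (with_proj (net I)) (src I i). eflow x i e = 0"
    using feas i unfolding lp_feasible_def by blast+
  show "st_flow (net I) (src I i) (snk I i) (dem I i) (flow_of I (rounded I x) i)"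
    unfolding st_flow_def sums using lp p dem by (simp add: flow)
qed (auto simp: routed_def)

lemma rounded_guarantee:
  assumes I: "anf_instance I" and x: "lp_optimal I x" and m: "9 \<le> num_edges I"
  defines "K \<equiv> routed I (rounded I x)"
  shows "(1 - 1 / real (num_edges I)) * max_throughput I \<le> throughput I K"
    and "\<And>e. e \<in> edges I \<Longrightarrow>
      load K (flow_of I (rounded I x)) e \<le> (1 + delta_beta (num_edges I)) * cap I e"
proof -
  show "(1 - 1 / real (num_edges I)) * max_throughput I \<le> throughput I K"
  \<comment> \<open>Without commodities \<open>w_max\<close> is the maximum of the empty set, and
    the estimator bounds do not apply.\<close>
  proof (cases "ncom I = 0")
    case True
    then have "max_throughput I \<le> 0" "throughput I K = 0"
      using max_throughput_le_lp_value[OF I x]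
      by (simp_all add: lp_value_def K_def routed_def throughput_def)
    then show ?thesis
      using m by (simp add: mult_nonneg_nonpos)
  next
    case False
    then have "(1 - 1 / real (num_edges I)) * lp_value I x \<le> throughput I K"
      using choices_guarantee(1)[OF I x _ m] by (simp add: throughput_def K_def routed_rounded)
    moreover have "(1 - 1 / real (num_edges I)) * max_throughput I \<le> (1 - 1 / real (num_edges I)) * lp_value I x"
      using m max_throughput_le_lp_value[OF I x] by (intro mult_left_mono) auto
    ultimately show ?thesis
      by simp
  qed
  fix e assume e: "e \<in> edges I"
  have cap: "0 < cap I e"
    using I e unfolding anf_instance_def by blast
  have B: "0 \<le> 1 + delta_beta (num_edges I)"
    using delta_beta_ge[OF m] by (simp add: b_const_def)
  show "load K (flow_of I (rounded I x)) e \<le> (1 + delta_beta (num_edges I)) * cap I e"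
  proof (cases "ncom I = 0")
    case True
    then show ?thesis
      using cap B by (simp add: load_def K_def routed_def)
  next
    case False
    have "load K (flow_of I (rounded I x)) e = (\<Sum>j\<in>K. share I x e j) * cap I e"
      unfolding load_def sum_distrib_right
      by (rule sum.cong) (use e cap in \<open>auto simp: K_def routed_rounded flow_of_def rounded_simps share_def\<close>)
    then show ?thesis
      using choices_guarantee(2)[OF I x _ m e] False cap by (simp add: K_def routed_rounded)
  qed
qed

section \<open>The program and its running time\<close>

lemma timed_simps [simp]:
  "result (bind_timed p q) = result (q (result p))"
  "steps (bind_timed p q) = steps p + steps (q (result p))"
  "result (tick a) = a"
  "steps (tick a) = 1"
  by (simp_all add: bind_timed_def tick_def)

lemma result_for_each: "result (for_each as s body) = fold (\<lambda>a s. result (body a s)) as s"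
  by (induction as arbitrary: s) simp_all

lemma steps_for_each_le:
  assumes "\<And>a s. a \<in> set as \<Longrightarrow> steps (body a s) \<le> B"
  shows "steps (for_each as s body) \<le> Suc (length as * Suc B)"
  using assms
proof (induction as arbitrary: s)
  case (Cons a as)
  have "steps (body a s) \<le> B"
    by (rule Cons.prems) simp
  moreover have "steps (for_each as t body) \<le> Suc (length as * Suc B)" for t
    by (rule Cons.IH) (use Cons.prems in auto)
  from this[of "result (body a s)"] have
    "steps (for_each as (result (body a s)) body) \<le> Suc (length as * Suc B)" .
  ultimately show ?case
    by simp
qed simp

lemma fold_add: "fold (\<lambda>a s. s + f a) as s = s + sum_list (map f as)"
  for s :: "'b :: comm_monoid_add"
  by (induction as arbitrary: s) (simp_all add: add.assoc)

lemma fold_mult: "fold (\<lambda>a s. s * f a) as s = s * prod_list (map f as)"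
  for s :: "'b :: comm_monoid_mult"
  by (induction as arbitrary: s) (simp_all add: mult.assoc)

lemma fold_max: "fold (\<lambda>a s. max s (f a)) as s = Max (insert s (f ` set as))"
  for s :: "'b :: linorder"
proof (induction as arbitrary: s)
  case (Cons a as)
  have "Max (insert (max s (f a)) (f ` set as)) = Max (insert s (insert (f a) (f ` set as)))"
    by (cases "f ` set as = {}") (simp_all add: max.assoc)
  then show ?case
    by (simp add: Cons.IH)
qed simp

lemma set_upt_Suc: "set [1..<Suc k] = {1..k}"
  by auto

lemma sum_list_upt: "sum_list (map f [1..<Suc k]) = (\<Sum>j\<in>{1..k}. f j)"
  using sum.distinct_set_conv_list[of "[1..<Suc k]" f] by (simp only: set_upt_Suc distinct_upt)

lemma prod_list_upt: "prod_list (map f [1..<Suc k]) = (\<Prod>j\<in>{1..k}. f j)"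
  using prod.distinct_set_conv_list[of "[1..<Suc k]" f] by (simp only: set_upt_Suc distinct_upt)

lemma edge_list:
  assumes "anf_instance I"
  shows "distinct (edge_list I)" "set (edge_list I) = edges I" "length (edge_list I) = num_edges I"
proof -
  have "finite (edges I)"
    using assms unfolding anf_instance_def pair_fin_digraph_def pair_fin_digraph_axioms_def by blast
  then have "\<exists>es. distinct es \<and> set es = edges I"
    using finite_distinct_list by blast
  from someI_ex[OF this] show d: "distinct (edge_list I)" and s: "set (edge_list I) = edges I"
    by (simp_all add: edge_list_def)
  show "length (edge_list I) = num_edges I"
    using distinct_card[OF d] s by simp
qed

lemma result_factor_prog: "result (factor_prog x z i \<theta> j a) = factor x z i \<theta> j a"
  by (simp add: factor_prog_def factor_def)

lemma result_count_edges:
  "anf_instance I \<Longrightarrow> result (for_each (edge_list I) 0 (\<lambda>_ s. tick (s + 1))) = real (num_edges I)"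
  using fold_add[of "\<lambda>_. 1 :: real" "edge_list I" 0]
  by (simp add: result_for_each edge_list(3) map_replicate_const sum_list_replicate)

lemma result_est_alpha_prog:
  assumes I: "anf_instance I"
  shows "result (est_alpha_prog I x z i) = alpha_val I x z i"
proof -
  let ?wm = "result (for_each [1..<Suc (ncom I)] 0 (\<lambda>j s. tick (max s (wt I j))))"
  let ?wl = "result (for_each [1..<Suc (ncom I)] 0
    (\<lambda>j s. do { y \<leftarrow> tick (wt I j * amount x j); tick (s + y) }))"
  have wl: "?wl = lp_value I x"
    unfolding result_for_each timed_simps fold_add sum_list_upt lp_value_def by simp
  have wm: "?wm = w_max I" if "ncom I \<noteq> 0"
  proof -
    have "?wm = Max (insert 0 (wt I ` {1..ncom I}))"
      unfolding result_for_each timed_simps fold_max set_upt_Suc ..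
    also have "\<dots> = max 0 (w_max I)"
      using that by (simp add: w_max_def)
    \<comment> \<open>Starting the maximum at 0 is harmless because weights are positive.\<close>
    also have "\<dots> = w_max I"
      using w_max_bounds(3)[OF I, of 1] that by simp
    finally show ?thesis .
  qed
  have mu: "?wl / ?wm = mu_tilde I x"
  \<comment> \<open>Without commodities the two maxima may differ, but both quotients have numerator
    0.\<close>
  proof (cases "ncom I = 0")
    case True
    then have "lp_value I x = 0"
      by (simp add: lp_value_def)
    then show ?thesis
      unfolding wl mu_tilde_def by simp
  next
    case False
    then show ?thesis
      unfolding wl wm[OF False] mu_tilde_def by simp
  qed
  have prod: "fold (\<lambda>j p. p * factor x z i \<theta> j (wt I j / ?wm)) [1..<Suc (ncom I)] 1 =
      (\<Prod>j\<in>{1..ncom I}. factor x z i \<theta> j (wt I j / w_max I))" for \<theta>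
  proof (cases "ncom I = 0")
    case False
    show ?thesis
      unfolding fold_mult wm[OF False] prod_list_upt by simp
  qed simp
  show ?thesis
    unfolding est_alpha_prog_def timed_simps result_count_edges[OF I] mu
    unfolding result_for_each[of _ 1] timed_simps result_factor_prog prod
    by (simp add: alpha_val_def alpha_const_def theta_alpha_def delta_alpha_def)
qed

lemma result_est_beta_prog:
  assumes I: "anf_instance I"
  shows "result (est_beta_prog I x e z i) = beta_val I x e z i"
proof -
  \<comment> \<open>The explicit test reproduces the convention \<open>y / 0 = 0\<close> behind
    \<open>share\<close>.\<close>
  have arg: "result (if amount x j \<noteq> 0 then do {
               n \<leftarrow> tick (dem I j * eflow x j e);
               c \<leftarrow> tick (amount x j * cap I e);
               tick (n / c)
             } else tick 0) = share I x e j" for j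
    by (simp add: share_def)
  have prod: "fold (\<lambda>j p. p * factor x z i \<theta> j (share I x e j)) [1..<Suc (ncom I)] 1 =
      (\<Prod>j\<in>{1..ncom I}. factor x z i \<theta> j (share I x e j))" for \<theta>
    unfolding fold_mult prod_list_upt by simp
  show ?thesis
    unfolding est_beta_prog_def timed_simps result_count_edges[OF I]
    unfolding result_for_each[of _ 1] timed_simps arg result_factor_prog prod
    by (simp add: beta_val_def beta_const_def theta_beta_def delta_beta_def)
qed

lemma result_Ex_est_prog:
  assumes I: "anf_instance I" and feas: "lp_feasible I x"
  shows "result (Ex_est_prog I x z i) = Ex_est I x z i"
  unfolding Ex_est_prog_def Ex_est_eq[OF feas] timed_simps result_for_each fold_add
    result_est_alpha_prog[OF I] result_est_beta_prog[OF I]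
  using edge_list[OF I] by (simp add: sum.distinct_set_conv_list[symmetric])

text \<open>The recursion of \<open>derand\<close> peels off the last round, hence the list is split
  at its end.\<close>

lemma fold_derand:
  "fold (\<lambda>i (z, F).
      let z' = z(i := \<not> (amount x i = 0 \<or> Ex_est I x (z(i := False)) i < F)) in (z', Ex_est I x z' i))
    [1..<Suc k] (\<lambda>_. False, Ex_est I x (\<lambda>_. False) 0) = derand I x k"
proof (induction k)
  case (Suc k)
  have upt: "[1..<Suc (Suc k)] = [1..<Suc k] @ [Suc k]"
    by simp
  show ?case
    unfolding upt fold_append o_apply Suc.IH by (simp add: derand.simps(2) Let_def)
qed simp

lemma fold_fun_upd:
  "distinct as \<Longrightarrow> fold (\<lambda>i f. f(i := c i)) as f = (\<lambda>i. if i \<in> set as then c i else f i)"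
  by (induction as arbitrary: f) (auto simp: fun_eq_iff)

lemma fold_fun_upd2:
  assumes "distinct as" "distinct bs"
  shows "fold (\<lambda>i g. fold (\<lambda>e g. g(i := (g i)(e := c i e))) bs g) as g =
    (\<lambda>i e. if i \<in> set as \<and> e \<in> set bs then c i e else g i e)"
proof -
  have inner: "fold (\<lambda>e g. g(i := (g i)(e := c i e))) bs g =
      g(i := (\<lambda>e. if e \<in> set bs then c i e else g i e))" for i g
    using assms(2) by (induction bs arbitrary: g) (auto simp: fun_eq_iff)
  show ?thesis
    using assms(1) unfolding inner by (induction as arbitrary: g) (auto simp: fun_eq_iff)
qed

lemma result_rounding_prog:
  assumes I: "anf_instance I" and feas: "lp_feasible I (result (lp_solver I))"
  shows "result (rounding_prog lp_solver I) = rounded I (result (lp_solver I))"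
proof -
  define x where "x = result (lp_solver I)"
  note Ex = result_Ex_est_prog[OF I feas, folded x_def]
  obtain z F where zF: "derand I x (ncom I) = (z, F)"
    by (cases "derand I x (ncom I)")
  then have z: "z = choices I x (ncom I)"
    by simp
  have loop: "result (for_each [1..<Suc (ncom I)] (\<lambda>_. False, Ex_est I x (\<lambda>_. False) 0) (\<lambda>i (z, F). do {
       zero \<leftarrow> tick (amount x i = 0);
       z0 \<leftarrow> tick (z(i := False));
       F0 \<leftarrow> Ex_est_prog I x z0 i;
       less \<leftarrow> tick (F0 < F);
       z \<leftarrow> tick (z(i := \<not> (zero \<or> less)));
       F \<leftarrow> Ex_est_prog I x z i;
       tick (z, F)
     })) = (z, F)"
    unfolding result_for_each zF[symmetric] fold_derand[symmetric]
    by (intro arg_cong[where f = "\<lambda>body. fold body [1..<Suc (ncom I)] _"] ext)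
      (simp add: Ex Let_def case_prod_beta)
  have amt: "result (for_each [1..<Suc (ncom I)] (\<lambda>_. 0)
      (\<lambda>i f. if z i then tick (f(i := 1)) else tick (f(i := 0)))) = amount (rounded I x)"
  proof -
    have "(\<lambda>i f. result (if z i then tick (f(i := 1)) else tick (f(i := 0)))) =
        (\<lambda>i (f :: nat \<Rightarrow> real). f(i := of_bool (z i)))"
      by (simp add: fun_eq_iff)
    \<comment> \<open>The choices are false outside \<open>{1..ncom I}\<close>, so entries left at
      their initial value 0 agree as well.\<close>
    then show ?thesis
      using choices_True[of I x "ncom I"]
      by (simp only: result_for_each fold_fun_upd[OF distinct_upt] set_upt_Suc)
        (auto simp: fun_eq_iff rounded_simps z)
  qed
  have flow: "result (for_each [1..<Suc (ncom I)] (\<lambda>_ _. 0) (\<lambda>i g.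
       for_each (edge_list I) g (\<lambda>e g. do {
         y \<leftarrow> (if z i then tick (eflow x i e / amount x i) else tick 0);
         tick (g(i := (g i)(e := y)))
       }))) = eflow (rounded I x)"
  proof -
    have "(\<lambda>e g. result (do {
         y \<leftarrow> (if z i then tick (eflow x i e / amount x i) else tick 0);
         tick (g(i := (g i)(e := y)))
       })) = (\<lambda>e g. g(i := (g i)(e := if z i then eflow x i e / amount x i else 0)))" for i
      by (simp add: fun_eq_iff)
    then show ?thesis
      using choices_True[of I x "ncom I"] edge_list(2)[OF I]
      by (simp only: result_for_each fold_fun_upd2[OF distinct_upt edge_list(1)[OF I]] set_upt_Suc)
        (auto simp: fun_eq_iff rounded_simps z)
  qed
  show ?thesis
    by (simp only: rounding_prog_def timed_simps x_def[symmetric] Ex loop prod.case amt flow) simp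
qed

section \<open>Step counts\<close>

lemma steps_tick_le: "steps (tick a) \<le> 1"
  by simp

text \<open>The bound on the continuation is uniform in its argument, so bounds compose without
  knowing intermediate results.\<close>

lemma steps_bind_le:
  assumes "steps p \<le> A" "\<And>a. steps (q a) \<le> B"
  shows "steps (bind_timed p q) \<le> A + B"
  using assms by (simp add: add_mono)

text \<open>Adding the two bounds instead of taking their maximum keeps all bounds polynomial
  expressions.\<close>

lemma steps_if_le:
  assumes "steps p \<le> A" "steps q \<le> B"
  shows "steps (if b then p else q) \<le> A + B"
  using assms by (simp add: trans_le_add1 trans_le_add2)

lemma steps_case_prod_le:
  assumes "\<And>a b. steps (f a b) \<le> B"
  shows "steps (case s of (a, b) \<Rightarrow> f a b) \<le> B"
  using assms by (cases s) simp

lemma steps_for_each_upt_le: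
  assumes "k \<le> n" "\<And>j s. steps (body j s) \<le> B"
  shows "steps (for_each [1..<Suc k] s body) \<le> 1 + n * (1 + B)"
proof -
  have "steps (for_each [1..<Suc k] s body) \<le> Suc (length [1..<Suc k] * Suc B)"
    using assms(2) by (intro steps_for_each_le)
  also have "\<dots> \<le> 1 + n * (1 + B)"
    using mult_le_mono1[OF assms(1), of "Suc B"] by (simp del: mult_Suc_right upt_Suc)
  finally show ?thesis .
qed

lemma steps_for_each_edges_le:
  assumes "anf_instance I" "num_edges I \<le> n" "\<And>e s. steps (body e s) \<le> B"
  shows "steps (for_each (edge_list I) s body) \<le> 1 + n * (1 + B)"
proof -
  have "steps (for_each (edge_list I) s body) \<le> Suc (length (edge_list I) * Suc B)"
    using assms(3) by (intro steps_for_each_le)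
  also have "\<dots> \<le> 1 + n * (1 + B)"
    using mult_le_mono1[OF assms(2), of "Suc B"] edge_list(3)[OF assms(1)]
    by (simp del: mult_Suc_right)
  finally show ?thesis .
qed

lemma steps_factor_prog_le: "steps (factor_prog x z i \<theta> j a) \<le> 8"
  by (simp add: factor_prog_def)

context
  fixes I :: "'v anf_instance" and n :: nat
  assumes I: "anf_instance I" and k: "ncom I \<le> n" and m: "num_edges I \<le> n"
begin

lemmas steps_le = steps_tick_le steps_bind_le steps_if_le steps_case_prod_le steps_factor_prog_le
  steps_for_each_upt_le[OF k] steps_for_each_edges_le[OF I m]

lemma steps_est_alpha_prog_le: "steps (est_alpha_prog I x z i) \<le> 100 * n + 100"
  \<comment> \<open>The intermediate bound left open by \<open>order_trans\<close> is assembled by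
    \<open>steps_le\<close> along the structure of the program; an arithmetic comparison
    remains.\<close>
  unfolding est_alpha_prog_def by (rule order_trans, (rule steps_le)+) simp

lemma steps_est_beta_prog_le: "steps (est_beta_prog I x e z i) \<le> 100 * n + 100"
  unfolding est_beta_prog_def by (rule order_trans, (rule steps_le)+) simp

lemma steps_Ex_est_prog_le: "steps (Ex_est_prog I x z i) \<le> 100 * n * n + 300 * n + 200"
  unfolding Ex_est_prog_def
  by (rule order_trans, (rule steps_le steps_est_alpha_prog_le steps_est_beta_prog_le)+)
    (simp add: algebra_simps)

text \<open>At most \<open>n\<close> rounds evaluate the estimator twice each, at quadratic cost;
  this dominates the loops that write the output.\<close>

lemma steps_rounding_prog_le:
  "steps (rounding_prog lp_solver I) \<le> steps (lp_solver I) + 1000 * (n + 1) ^ 3"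
  unfolding rounding_prog_def
  by (rule order_trans, (rule steps_le steps_Ex_est_prog_le order_refl[of "steps (lp_solver I)"])+)
    (simp add: algebra_simps power3_eq_cube)

end

lemma polytime_rounding_prog:
  assumes isize: "\<And>I. anf_instance I \<Longrightarrow> num_edges I + ncom I \<le> isize I"
    and lp: "polytime isize {I. anf_instance I} lp_solver"
  shows "polytime isize {I. anf_instance I} (rounding_prog lp_solver)"
proof -
  obtain p :: "nat poly" where p: "\<And>I. anf_instance I \<Longrightarrow> steps (lp_solver I) \<le> poly p (isize I)"
    using lp unfolding polytime_def by blast
  \<comment> \<open>\<open>[:1, 1:]\<close> is the polynomial X + 1, and \<open>isize I\<close>
    takes the place of \<open>n\<close>.\<close>
  have "steps (rounding_prog lp_solver I) \<le> poly (p + smult 1000 ([:1, 1:] ^ 3)) (isize I)"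
    if "anf_instance I" for I
    using steps_rounding_prog_le[OF that, of "isize I" lp_solver] isize[OF that] p[OF that]
    by (simp add: add.commute)
  then show ?thesis
    unfolding polytime_def by blast
qed

theorem theorem6p2:
  fixes isize :: "'v anf_instance \<Rightarrow> nat"
    and lp_solver :: "'v anf_instance \<Rightarrow> 'v frac_solution timed"
  assumes isize: "\<And>I. anf_instance I \<Longrightarrow>
      card (pverts (net I)) + num_edges I + ncom I \<le> isize I"
    and lp_optimal: "\<And>I. anf_instance I \<Longrightarrow> lp_optimal I (result (lp_solver I))"
    and lp_polytime: "polytime isize {I. anf_instance I} lp_solver"
  shows "(\<forall>I. anf_instance I \<and> num_edges I \<ge> 9 \<longrightarrow>
            result (rounding_prog lp_solver I) = rounded I (result (lp_solver I))) \<and>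
         det_approximation isize {I. anf_instance I \<and> num_edges I \<ge> 9}
           (\<lambda>I. 1 - 1 / real (num_edges I))
           (\<lambda>I. 3 * b_const * ln (real (num_edges I)) / ln (ln (real (num_edges I))))
           (rounding_prog lp_solver)"
proof -
  have feas: "lp_feasible I (result (lp_solver I))" if "anf_instance I" for I
    using lp_optimal[OF that] by (simp add: lp_optimal_def)
  have eq: "result (rounding_prog lp_solver I) = rounded I (result (lp_solver I))"
    if "anf_instance I" for I
    by (intro result_rounding_prog that feas)
  have "polytime isize {I. anf_instance I} (rounding_prog lp_solver)"
    \<comment> \<open>Dropping the number of vertices from the lower bound on \<open>isize\<close>
      leaves the edges and commodities, which bound all loops.\<close>
    using isize add_leD2 by (intro polytime_rounding_prog lp_polytime) (metis add.assoc)
  then have "polytime isize {I. anf_instance I \<and> num_edges I \<ge> 9} (rounding_prog lp_solver)"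
    unfolding polytime_def by blast
  moreover have "let x = result (rounding_prog lp_solver I); K = routed I x; g = flow_of I x in
      (\<forall>i\<in>{1..ncom I}. amount x i \<in> {0, 1}) \<and>
      (\<forall>i\<in>{1..ncom I} - K. \<forall>e\<in>edges I. eflow x i e = 0) \<and>
      anf_solution I K g \<and>
      throughput I K \<ge> (1 - 1 / real (num_edges I)) * max_throughput I \<and>
      (\<forall>e\<in>edges I. load K g e \<le>
        3 * b_const * ln (real (num_edges I)) / ln (ln (real (num_edges I))) * cap I e)"
    if I: "anf_instance I" and m: "9 \<le> num_edges I" for I
    unfolding eq[OF I] Let_def
  proof (intro conjI ballI)
    let ?x = "rounded I (result (lp_solver I))"
    show "amount ?x i \<in> {0, 1}" for i
      by (simp add: rounded_simps)
    show "eflow ?x i e = 0" if "i \<in> {1..ncom I} - routed I ?x" for i e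
      using that by (simp add: rounded_simps routed_rounded)
    show "anf_solution I (routed I ?x) (flow_of I ?x)"
      by (rule anf_solution_rounded[OF I feas[OF I]])
    show "throughput I (routed I ?x) \<ge> (1 - 1 / real (num_edges I)) * max_throughput I"
      by (rule rounded_guarantee(1)[OF I lp_optimal[OF I] m])
    show "load (routed I ?x) (flow_of I ?x) e \<le>
        3 * b_const * ln (real (num_edges I)) / ln (ln (real (num_edges I))) * cap I e"
      if "e \<in> edges I" for e
      using rounded_guarantee(2)[OF I lp_optimal[OF I] m that] by (simp add: delta_beta_def)
  qed
  ultimately show ?thesis
    using eq unfolding det_approximation_def by blast
qed

end
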